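(* Let $k\ge1$ be an integer and $G$ a finite group. Then $$1+\sum_{n\ge1}\chi^{(k)}({\rm pt},G_n)\,t^n=\left(\prod_{r_1,\dots,r_k\ge1}\left(1-t^{r_1r_2\cdots r_k}\right)^{r_2r_3^2\cdots r_k^{k-1}}\right)^{-\chi^{(k)}({\rm pt},G)},$$ where $\chi^{(k)}({\rm pt},G)=\frac{1}{|G|}\,|{\rm Hom}(\mathbb Z^{k+1},G)|$ (i.e. $1/|G|$ times the number of $(k+1)$-tuples of pairwise commuting elements of $G$) and similarly $\chi^{(k)}({\rm pt},G_n)=\frac1{|G_n|}|{\rm Hom}(\mathbb Z^{k+1},G_n)|$.
   Context: $G_n=G\wr S_n=G^n\rtimes S_n$ is the wreath product with multiplication $((g_1,\dots,g_n),s)((g'_1,\dots,g'_n),s')=((g_1g'_{s^{-1}(1)},\dots,g_ng'_{s^{-1}(n)}),ss')$, of order $|G|^n n!$. For $f\in1+t\mathbb Q[[t]]$ and $c\in\mathbb Q$, $f^c=\exp(c\log f)$; the infinite product converges $t$-adically. *)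

theory Defs
  imports "HOL-Analysis.Analysis" "HOL-Algebra.Group"
    "HOL-Computational_Algebra.Formal_Power_Series"
begin

definition wreath :: "('a, 'b) monoid_scheme \<Rightarrow> nat \<Rightarrow> ((nat \<Rightarrow> 'a) \<times> (nat \<Rightarrow> nat)) monoid" where
  "wreath G n =
     \<lparr> carrier = ({0..<n} \<rightarrow>\<^sub>E carrier G) \<times> {s. s permutes {0..<n}},
       mult = (\<lambda>(g, s) (g', s'). ((\<lambda>i\<in>{0..<n}. g i \<otimes>\<^bsub>G\<^esub> g' (inv_into UNIV s i)), s \<circ> s')),
       one = ((\<lambda>i\<in>{0..<n}. \<one>\<^bsub>G\<^esub>), id) \<rparr>"

text \<open>Hom(Z^(k+1), H), identified with (k+1)-tuples of pairwise commuting elements.\<close>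
definition commuting_tuples :: "nat \<Rightarrow> ('a, 'b) monoid_scheme \<Rightarrow> (nat \<Rightarrow> 'a) set" where
  "commuting_tuples k H =
     {x \<in> {0..k} \<rightarrow>\<^sub>E carrier H. \<forall>i\<le>k. \<forall>j\<le>k. x i \<otimes>\<^bsub>H\<^esub> x j = x j \<otimes>\<^bsub>H\<^esub> x i}"

definition chi :: "nat \<Rightarrow> ('a, 'b) monoid_scheme \<Rightarrow> rat" where
  "chi k H = of_nat (card (commuting_tuples k H)) / of_nat (card (carrier H))"

text \<open>f^c = exp(c log f) for f with constant term 1.\<close>
definition fps_log :: "rat fps \<Rightarrow> rat fps" where
  "fps_log f = fps_ln 1 oo (f - 1)"

definition fps_powr :: "rat fps \<Rightarrow> rat \<Rightarrow> rat fps" where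
  "fps_powr f c = fps_exp 1 oo (fps_const c * fps_log f)"

definition partial_prod :: "nat \<Rightarrow> nat \<Rightarrow> rat fps" where
  "partial_prod k N =
     (\<Prod>r\<in>{1..k} \<rightarrow>\<^sub>E {1..N}.
        (1 - fps_X ^ (\<Prod>i\<in>{1..k}. r i)) ^ (\<Prod>i\<in>{1..k}. r i ^ (i - 1)))"

end

theory Submission
  imports Defs
begin

text \<open>
  Left translations identify \<open>G\<close> with a finite group \<open>L\<close> of bijections, and \<open>G\<^sub>n\<close> with the
  automorphisms of the trivial \<open>L\<close>-bundle over \<open>n\<close> points, so a commuting \<open>(k+1)\<close>-tuple is a bundle with
  an action of \<open>\<int>\<^bsup>k+1\<^esup>\<close>. Splitting off the orbit of a base point gives
  \<open>n a\<^sub>n = \<Sum>\<^sub>d \<tau>\<^sub>d a\<^bsub>n-d\<^esub>\<close> for \<open>a\<^sub>n = |Hom(\<int>\<^bsup>k+1\<^esup>, G\<^sub>n)| / |G\<^sub>n|\<close>, where \<open>\<tau>\<^sub>d\<close> is the normalised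
  number of actions that are transitive on \<open>d\<close> base points.

  Transitive actions are counted one generator at a time. If \<open>x\<^sub>1, \<dots>, x\<^sub>j\<close>, \<open>x\<close> act transitively on \<open>r\<close>
  points, then \<open>x\<close> permutes the orbits of \<open>x\<^sub>1, \<dots>, x\<^sub>j\<close> cyclically; the action is recovered from one
  orbit \<open>U\<close> with \<open>d\<close> points, where \<open>r = d m\<close>, the restrictions of the \<open>x\<^sub>i\<close> and of \<open>x\<^sup>m\<close> to \<open>U\<close>, and the
  identifications of \<open>U\<close> with its translates. Modulo the \<open>d\<close> translations of \<open>U\<close>, the monodromy \<open>x\<^sup>m\<close>
  fixes the base, so it survives as a base-trivial element; in the end only commuting tuples of \<open>L\<close>
  remain. The factors \<open>d\<close> accumulate to the recursion for the number \<open>s\<close> of sublattices, and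
  \<open>\<tau>\<^sub>d = \<chi>\<^bsup>(k)\<^esup>(pt, G) s\<^bsub>k+1\<^esub>(d)\<close>. Hence \<open>t F'/F\<close> is for both sides \<open>F\<close> of the identity equal to
  \<open>\<chi>\<^bsup>(k)\<^esup>(pt, G) \<Sum>\<^sub>d s\<^bsub>k+1\<^esub>(d) t\<^sup>d\<close>.
\<close>

unbundle no vec_syntax and fps_syntax

section \<open>Logarithmic derivatives of formal power series\<close>

lemma fps_X_mult_deriv_nth: "(fps_X * fps_deriv f) $ n = of_nat n * (f $ n :: 'a::comm_ring_1)"
  by (cases n) simp_all

text \<open>As \<open>l $ 0 = 0\<close>, the coefficient of degree n expresses
  \<open>n * f $ n\<close> through earlier coefficients of \<open>f\<close> and those of
  \<open>l\<close> up to degree n, so \<open>f\<close> is determined recursively. The cut-off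
  \<open>N\<close> makes this usable for truncated products, whose logarithmic derivative is known
  only up to degree \<open>N\<close>.\<close>

lemma log_deriv_unique:
  fixes f g l m :: "rat fps"
  assumes "fps_X * fps_deriv f = f * l" "fps_X * fps_deriv g = g * m"
    and "f $ 0 = g $ 0" "l $ 0 = 0" "\<And>i. i \<le> N \<Longrightarrow> l $ i = m $ i" "n \<le> N"
  shows "f $ n = g $ n"
  using assms(6)
proof (induction n rule: less_induct)
  case (less n)
  show ?case
  proof (cases "n = 0")
    case False
    have m0: "m $ 0 = 0" using assms(4) assms(5)[of 0] by simp
    have "of_nat n * f $ n = (f * l) $ n"
      using fps_X_mult_deriv_nth[of f n] by (simp only: assms(1))
    also have "\<dots> = (\<Sum>i=0..n. f $ i * l $ (n - i))" by (rule fps_mult_nth)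
    also have "\<dots> = (\<Sum>i=0..n. g $ i * m $ (n - i))"
    proof (rule sum.cong)
      fix i assume "i \<in> {0..n}"
      then show "f $ i * l $ (n - i) = g $ i * m $ (n - i)"
        using less assms(4,5) m0 by (cases "i = n") auto
    qed simp
    also have "\<dots> = (g * m) $ n" by (rule fps_mult_nth[symmetric])
    also have "\<dots> = of_nat n * g $ n"
      using fps_X_mult_deriv_nth[of g n] by (simp only: assms(2))
    finally show ?thesis using False by simp
  qed (use assms in simp)
qed

lemma fps_log_deriv:
  assumes "f $ 0 = 1"
  shows "fps_deriv (fps_log f) = inverse f * fps_deriv f"
proof -
  have "fps_deriv (fps_log f) = (inverse (1 + fps_X) oo (f - 1)) * fps_deriv f"
    using assms by (simp add: fps_log_def fps_compose_deriv fps_ln_deriv)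
  also have "inverse (1 + fps_X) oo (f - 1) = inverse ((1 + fps_X) oo (f - 1))"
    using assms by (intro fps_inverse_compose) auto
  also have "(1 + fps_X) oo (f - 1) = f"
    using assms by (simp add: fps_compose_add_distrib)
  finally show ?thesis .
qed

lemma fps_powr_nth_0 [simp]: "fps_powr f c $ 0 = 1"
  by (simp add: fps_powr_def)

text \<open>By the chain rule the derivative of exp(c log f) is c f'/f times itself, and the
  constant term 1 makes \<open>f\<close> invertible. Exponents thus act on logarithmic derivatives
  as scalars.\<close>

lemma fps_powr_log_deriv:
  assumes "f $ 0 = 1" "fps_X * fps_deriv f = f * l"
  shows "fps_X * fps_deriv (fps_powr f c) = fps_powr f c * (fps_const c * l)"
proof -
  have 0: "(fps_const c * fps_log f) $ 0 = 0" by (simp add: fps_log_def)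
  have "fps_deriv (fps_powr f c) = fps_powr f c * (fps_const c * (inverse f * fps_deriv f))"
    unfolding fps_powr_def fps_compose_deriv[OF 0] by (simp add: fps_log_deriv[OF assms(1)])
  then have "fps_X * fps_deriv (fps_powr f c) = fps_powr f c * (fps_const c * (inverse f * (fps_X * fps_deriv f)))"
    by (simp add: mult_ac)
  also have "inverse f * (fps_X * fps_deriv f) = l"
    unfolding assms(2) using inverse_mult_eq_1[of f] assms(1) by (simp add: mult.assoc[symmetric])
  finally show ?thesis .
qed

text \<open>For \<open>\<int>\<^sup>j\<close> this is the number of sublattices of index \<open>n\<close>.\<close>

fun sublattices :: "nat \<Rightarrow> nat \<Rightarrow> nat" where
  "sublattices 0 n = (if n = 1 then 1 else 0)"
| "sublattices (Suc j) n = (\<Sum>d | d dvd n. d * sublattices j d)"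

lemma sublattices_0 [simp]: "sublattices j 0 = 0"
proof (cases j)
  case (Suc i)
  \<comment> \<open>Every number divides 0, and a sum over an infinite set is 0 by
    convention.\<close>
  have "infinite {d::nat. d dvd 0}" by simp
  then show ?thesis using Suc by simp
qed simp

section \<open>The infinite product and its logarithmic derivative\<close>

definition tuples :: "nat \<Rightarrow> nat \<Rightarrow> nat \<Rightarrow> (nat \<Rightarrow> nat) set" where
  "tuples k N n = {r \<in> {1..k} \<rightarrow>\<^sub>E {1..N}. (\<Prod>i\<in>{1..k}. r i) = n}"

lemma finite_tuples: "finite (tuples k N n)"
  unfolding tuples_def by (rule finite_subset[of _ "{1..k} \<rightarrow>\<^sub>E {1..N}"]) (auto intro: finite_PiE)

lemma prod_atLeast1_Suc: "(\<Prod>i\<in>{1..Suc k}. f i) = f 1 * (\<Prod>i\<in>{1..k}. f (Suc i))"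
  for f :: "nat \<Rightarrow> nat"
proof -
  have "(\<Prod>i\<in>{1..Suc k}. f i) = f 1 * (\<Prod>i\<in>{Suc 1..Suc k}. f i)"
    by (rule prod.atLeast_Suc_atMost) simp
  also have "(\<Prod>i\<in>{Suc 1..Suc k}. f i) = (\<Prod>i\<in>{1..k}. f (Suc i))"
    by (rule prod.shift_bounds_cl_Suc_ivl)
  finally show ?thesis .
qed

text \<open>Split off \<open>r 1\<close> and shift the other entries down by one. They multiply to a
  divisor d of n, and the shift lowers each exponent by one, so a factor d comes out of the weight:
  this is the recursion of \<open>sublattices\<close>. For positive n \<le> N the bound on the
  entries loses no factorisation.\<close>

lemma sublattices_eq_sum_tuples:
  assumes "n \<le> N"
  shows "sublattices k n = (\<Sum>r\<in>tuples k N n. \<Prod>i\<in>{1..k}. r i ^ (i - 1))"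
  using assms
proof (induction k arbitrary: n)
  case 0
  then show ?case by (auto simp: tuples_def PiE_empty_domain)
next
  case (Suc k)
  show ?case
  proof (cases "n = 0")
    case True
    have "tuples (Suc k) N 0 = {}"
      by (auto simp: tuples_def PiE_iff Ball_def)
    then show ?thesis using True by simp
  next
    case False
    \<comment> \<open>\<open>E a r\<close> puts \<open>a\<close> in front of \<open>r\<close>; with
      \<open>a = n div d\<close> it inverts the splitting, since n is positive here.\<close>
    define E where "E a r = (\<lambda>i\<in>{1..Suc k}. if i = 1 then a else r (i - 1))" for a :: nat and r :: "nat \<Rightarrow> nat"
    have "sublattices (Suc k) n = (\<Sum>d | d dvd n. \<Sum>r\<in>tuples k N d. d * (\<Prod>i\<in>{1..k}. r i ^ (i - 1)))"
      using Suc False by (auto simp: sum_distrib_left intro!: sum.cong dest: dvd_imp_le)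
    also have "\<dots> = (\<Sum>(d, r)\<in>(SIGMA d:{d. d dvd n}. tuples k N d). d * (\<Prod>i\<in>{1..k}. r i ^ (i - 1)))"
      using False by (intro sum.Sigma) (auto simp: finite_tuples)
    also have "\<dots> = (\<Sum>r\<in>tuples (Suc k) N n. \<Prod>i\<in>{1..Suc k}. r i ^ (i - 1))"
    proof (rule sum.reindex_bij_witness[of _ "\<lambda>r. (\<Prod>i\<in>{1..k}. r (Suc i), \<lambda>i\<in>{1..k}. r (Suc i))"
          "\<lambda>(d, r). E (n div d) r"])
      fix a assume "a \<in> (SIGMA d:{d. d dvd n}. tuples k N d)"
      then obtain d r where a: "a = (d, r)" "d dvd n" "r \<in> tuples k N d" by auto
      have r: "r \<in> {1..k} \<rightarrow>\<^sub>E {1..N}" "(\<Prod>i\<in>{1..k}. r i) = d" using a by (auto simp: tuples_def)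
      have ES: "E (n div d) r (Suc i) = r i" if "i \<in> {1..k}" for i using that by (auto simp: E_def)
      have E1: "E (n div d) r 1 = n div d" by (simp add: E_def)
      have "(\<Prod>i\<in>{1..k}. E (n div d) r (Suc i)) = d"
        by (rule trans[OF prod.cong[OF refl ES] r(2)])
      moreover have "(\<lambda>i\<in>{1..k}. E (n div d) r (Suc i)) = (\<lambda>i\<in>{1..k}. r i)"
        using ES by (intro restrict_ext) auto
      ultimately show "(\<lambda>r. (\<Prod>i\<in>{1..k}. r (Suc i), \<lambda>i\<in>{1..k}. r (Suc i))) (case a of (d, r) \<Rightarrow> E (n div d) r) = a"
        using PiE_restrict[OF r(1)] by (simp only: a(1) prod.case)
      have d0: "0 < d" using a(2) False by (auto intro: Nat.gr0I)
      have nd: "1 \<le> n div d"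
        using a(2) False d0 by (simp add: div_greater_zero_iff dvd_imp_le Suc_le_eq)
      have nd': "n div d \<le> N"
        using Suc.prems div_le_dividend order_trans by blast
      have "E (n div d) r \<in> {1..Suc k} \<rightarrow>\<^sub>E {1..N}"
      proof (rule PiE_I)
        fix i assume "i \<in> {1..Suc k}"
        then consider "i = 1" | j where "i = Suc j" "j \<in> {1..k}"
          by (cases "i = 1"; cases i) (auto simp: Suc_le_eq)
        then show "E (n div d) r i \<in> {1..N}"
        proof cases
          case 2
          then show ?thesis using ES PiE_mem[OF r(1)] by simp
        qed (use E1 nd nd' in auto)
      qed (auto simp: E_def)
      moreover have "(\<Prod>i\<in>{1..Suc k}. E (n div d) r i) = n"
        unfolding prod_atLeast1_Suc using E1 ES r(2) a(2) by simp
      ultimately show "(case a of (d, r) \<Rightarrow> E (n div d) r) \<in> tuples (Suc k) N n"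
        by (simp add: a(1) tuples_def)
      have "(\<Prod>i\<in>{1..Suc k}. E (n div d) r i ^ (i - 1)) = (\<Prod>i\<in>{1..k}. r i ^ i)"
        unfolding prod_atLeast1_Suc using ES by simp
      also have "\<dots> = (\<Prod>i\<in>{1..k}. r i * r i ^ (i - 1))"
        by (intro prod.cong) (auto simp: power_eq_if)
      also have "\<dots> = d * (\<Prod>i\<in>{1..k}. r i ^ (i - 1))"
        using r(2) by (simp add: prod.distrib)
      finally show "(\<Prod>i\<in>{1..Suc k}. (case a of (d, r) \<Rightarrow> E (n div d) r) i ^ (i - 1)) =
          (case a of (d, r) \<Rightarrow> d * (\<Prod>i\<in>{1..k}. r i ^ (i - 1)))"
        by (simp add: a(1))
    next
      fix r assume "r \<in> tuples (Suc k) N n"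
      then have r: "r \<in> {1..Suc k} \<rightarrow>\<^sub>E {1..N}" "r 1 * (\<Prod>i\<in>{1..k}. r (Suc i)) = n"
        unfolding tuples_def prod_atLeast1_Suc by auto
      let ?d = "\<Prod>i\<in>{1..k}. r (Suc i)"
      have "n div D = r 1" if "r 1 * D = n" for D
        using that False by (cases "D = 0") auto
      from this[OF r(2)] have "n div ?d = r 1" .
      moreover have "E (r 1) (\<lambda>i\<in>{1..k}. r (Suc i)) i = r i" for i
      proof -
        consider "i = 1" | j where "i = Suc j" "j \<in> {1..k}" | "i \<notin> {1..Suc k}"
          by (cases "i = 1"; cases i) (auto simp: Suc_le_eq less_Suc_eq_le)
        then show ?thesis
        proof cases
          case 3
          then have "E (r 1) (\<lambda>i\<in>{1..k}. r (Suc i)) i = undefined" by (simp only: E_def restrict_def if_False)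
          then show ?thesis using PiE_arb[OF r(1) 3] by simp
        qed (auto simp: E_def)
      qed
      ultimately show "(case (?d, \<lambda>i\<in>{1..k}. r (Suc i)) of (d, r) \<Rightarrow> E (n div d) r) = r"
        by (simp only: prod.case) (rule ext)
      have "(\<lambda>i\<in>{1..k}. r (Suc i)) \<in> tuples k N ?d"
        using r(1) by (auto simp: tuples_def PiE_iff)
      then show "(?d, \<lambda>i\<in>{1..k}. r (Suc i)) \<in> (SIGMA d:{d. d dvd n}. tuples k N d)"
        using r(2) by auto
    qed
    finally show ?thesis .
  qed
qed

text \<open>For \<open>e = 1\<close> this is a geometric series: -R t^R / (1 - t^R) has coefficient
  -R at the positive multiples of R. The Leibniz rule then multiplies it by
  \<open>e\<close>.\<close>

lemma one_minus_X_power_log_deriv: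
  fixes R e :: nat
  assumes "R \<ge> 1"
  shows "fps_X * fps_deriv ((1 - fps_X ^ R) ^ e :: rat fps) =
     (1 - fps_X ^ R) ^ e * Abs_fps (\<lambda>n. if n \<noteq> 0 \<and> R dvd n then - of_nat (R * e) else 0)"
proof -
  let ?q = "1 - fps_X ^ R :: rat fps"
  let ?l = "Abs_fps (\<lambda>n. if n \<noteq> 0 \<and> R dvd n then - of_nat R else 0) :: rat fps"
  have base: "fps_X * fps_deriv ?q = ?q * ?l"
  proof (rule fps_ext)
    fix n
    have "(?q * ?l) $ n = ?l $ n - (if n < R then 0 else ?l $ (n - R))"
      by (simp add: left_diff_distrib fps_X_power_mult_nth)
    also have "\<dots> = of_nat n * (?q $ n)"
      using assms by (auto simp: fps_X_power_nth dvd_minus_self dest: dvd_imp_le)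
    finally show "(fps_X * fps_deriv ?q) $ n = (?q * ?l) $ n" by (simp only: fps_X_mult_deriv_nth)
  qed
  have "fps_X * fps_deriv (?q ^ e) = ?q ^ e * (of_nat e * ?l)"
  proof (induction e)
    case (Suc e)
    have "fps_X * fps_deriv (?q ^ Suc e) = (fps_X * fps_deriv ?q) * ?q ^ e + ?q * (fps_X * fps_deriv (?q ^ e))"
      by (simp only: power_Suc fps_deriv_mult) (simp only: algebra_simps)
    also have "\<dots> = ?q ^ Suc e * (of_nat (Suc e) * ?l)"
      unfolding base Suc power_Suc of_nat_Suc by (simp only: algebra_simps mult_1_left)
    finally show ?case .
  qed simp
  also have "of_nat e * ?l = Abs_fps (\<lambda>n. if n \<noteq> 0 \<and> R dvd n then - of_nat (R * e) else 0)"
    by (rule fps_ext) (simp add: fps_of_nat[symmetric] del: fps_of_nat)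
  finally show ?thesis .
qed

lemma prod_log_deriv:
  fixes f l :: "'b \<Rightarrow> rat fps"
  assumes "finite A" "\<And>r. r \<in> A \<Longrightarrow> fps_X * fps_deriv (f r) = f r * l r"
  shows "fps_X * fps_deriv (prod f A) = prod f A * sum l A"
  using assms
proof (induction A rule: finite_induct)
  case (insert a A)
  have "fps_X * fps_deriv (prod f (insert a A)) =
      (fps_X * fps_deriv (f a)) * prod f A + f a * (fps_X * fps_deriv (prod f A))"
    using insert(1,2) by (simp add: algebra_simps)
  also have "\<dots> = prod f (insert a A) * sum l (insert a A)"
    using insert by (simp add: algebra_simps)
  finally show ?case .
qed simp

text \<open>The factor belonging to r contributes -R e at the positive multiples of its product R,
  where e is its exponent. Grouping the tuples by R = d turns the coefficient of t^n into minus the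
  sum of \<open>d * sublattices k d\<close> over the divisors d of n. Beyond degree N, tuples with
  larger entries are missing.\<close>

lemma partial_prod_log_deriv:
  "\<exists>l. fps_X * fps_deriv (partial_prod k N) = partial_prod k N * l \<and>
     (\<forall>n\<le>N. l $ n = - of_nat (sublattices (Suc k) n))"
proof -
  let ?A = "{1..k} \<rightarrow>\<^sub>E {1..N}"
  let ?R = "\<lambda>r::nat\<Rightarrow>nat. \<Prod>i\<in>{1..k}. r i" and ?e = "\<lambda>r::nat\<Rightarrow>nat. \<Prod>i\<in>{1..k}. r i ^ (i - 1)"
  let ?l = "\<lambda>r. Abs_fps (\<lambda>n. if n \<noteq> 0 \<and> ?R r dvd n then - of_nat (?R r * ?e r) else 0) :: rat fps"
  have fin: "finite ?A" by (rule finite_PiE) auto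
  have 1: "fps_X * fps_deriv (partial_prod k N) = partial_prod k N * sum ?l ?A"
    unfolding partial_prod_def
  proof (rule prod_log_deriv[OF fin])
    fix r assume "r \<in> ?A"
    then have "1 \<le> ?R r" by (intro prod_ge_1) (auto simp: PiE_iff)
    then show "fps_X * fps_deriv ((1 - fps_X ^ ?R r) ^ ?e r) = (1 - fps_X ^ ?R r) ^ ?e r * ?l r"
      by (rule one_minus_X_power_log_deriv)
  qed
  have "sum ?l ?A $ n = - of_nat (sublattices (Suc k) n)" if "n \<le> N" for n
  proof (cases "n = 0")
    case True
    then show ?thesis by (simp add: fps_sum_nth del: sublattices.simps)
  next
    case False
    have "(\<Sum>r\<in>?A. if ?R r dvd n then ?R r * ?e r else 0) = (\<Sum>r\<in>{r\<in>?A. ?R r dvd n}. ?R r * ?e r)"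
      by (rule sum.inter_filter[OF fin, symmetric])
    also have "\<dots> = (\<Sum>d | d dvd n. \<Sum>r\<in>{r\<in>{r\<in>?A. ?R r dvd n}. ?R r = d}. ?R r * ?e r)"
      using False fin by (intro sum.group[symmetric]) auto
    also have "\<dots> = (\<Sum>d | d dvd n. \<Sum>r\<in>tuples k N d. d * ?e r)"
      by (intro sum.cong) (auto simp: tuples_def)
    also have "\<dots> = sublattices (Suc k) n"
      unfolding sublattices.simps sum_distrib_left[symmetric]
    proof (rule sum.cong)
      fix d assume "d \<in> {d. d dvd n}"
      then have "d \<le> N" using that False dvd_imp_le[of d n] by simp
      then show "d * (\<Sum>r\<in>tuples k N d. ?e r) = d * sublattices k d"
        by (simp only: sublattices_eq_sum_tuples)
    qed simp
    finally have "of_nat (sublattices (Suc k) n) = (of_nat (\<Sum>r\<in>?A. if ?R r dvd n then ?R r * ?e r else 0) :: rat)"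
      by (simp only:)
    also have "\<dots> = (\<Sum>r\<in>?A. if ?R r dvd n then of_nat (?R r * ?e r) else 0)"
      unfolding of_nat_sum by (intro sum.cong) auto
    finally have "- of_nat (sublattices (Suc k) n) = (\<Sum>r\<in>?A. if ?R r dvd n then - of_nat (?R r * ?e r) else (0::rat))"
      by (simp only: sum_negf[symmetric] if_distrib[of uminus] minus_zero)
    then show ?thesis using False by (simp only: fps_sum_nth fps_nth_Abs_fps) simp
  qed
  then show ?thesis using 1 by blast
qed

lemma fps_prod_nth_0: "prod f A $ 0 = (\<Prod>a\<in>A. f a $ 0)" for f :: "'b \<Rightarrow> 'c::comm_ring_1 fps"
  by (induction A rule: infinite_finite_induct) auto

lemma partial_prod_nth_0: "partial_prod k N $ 0 = 1"
proof -
  have "(1 - fps_X ^ (\<Prod>i\<in>{1..k}. r i)) $ 0 = (1::rat)" if "r \<in> {1..k} \<rightarrow>\<^sub>E {1..N}" for r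
  proof -
    have "1 \<le> (\<Prod>i\<in>{1..k}. r i)" using that by (intro prod_ge_1) (auto simp: PiE_iff)
    then have "(\<Prod>i\<in>{1..k}. r i) \<noteq> 0" by linarith
    then show ?thesis by (simp only: fps_sub_nth fps_X_power_nth fps_one_nth) simp
  qed
  then show ?thesis unfolding partial_prod_def fps_prod_nth_0 fps_power_zeroth by simp
qed

text \<open>The limit is built outright as the exponential of a series with the right logarithmic
  derivative. By \<open>log_deriv_unique\<close> coefficient n of the partial products is final once
  N \<ge> n.\<close>

lemma partial_prod_tendsto:
  "\<exists>Q. partial_prod k \<longlonglongrightarrow> Q \<and> Q $ 0 = 1 \<and>
     fps_X * fps_deriv Q = Q * Abs_fps (\<lambda>n. - of_nat (sublattices (Suc k) n))"
proof -
  \<comment> \<open>Dividing by n inverts \<open>fps_X * fps_deriv\<close> outside degree 0, where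
    division by zero gives 0.\<close>
  define L where "L = Abs_fps (\<lambda>n. - of_nat (sublattices (Suc k) n) / of_nat n :: rat)"
  define Q where "Q = fps_exp 1 oo L"
  have L0: "L $ 0 = 0" by (simp add: L_def)
  have Q0: "Q $ 0 = 1" by (simp add: Q_def)
  have "fps_X * fps_deriv L = Abs_fps (\<lambda>n. - of_nat (sublattices (Suc k) n))"
    by (rule fps_ext, subst fps_X_mult_deriv_nth) (simp add: L_def del: sublattices.simps)
  then have dQ: "fps_X * fps_deriv Q = Q * Abs_fps (\<lambda>n. - of_nat (sublattices (Suc k) n))"
    unfolding Q_def fps_compose_deriv[OF L0] by (simp add: algebra_simps)
  have "partial_prod k \<longlonglongrightarrow> Q"
  proof (rule tendsto_fpsI)
    fix n
    have "partial_prod k N $ n = Q $ n" if "n \<le> N" for N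
    proof -
      obtain l where l: "fps_X * fps_deriv (partial_prod k N) = partial_prod k N * l"
        "\<forall>n\<le>N. l $ n = - of_nat (sublattices (Suc k) n)"
        using partial_prod_log_deriv by blast
      show ?thesis
      proof (rule log_deriv_unique[OF l(1) dQ])
        show "l $ 0 = 0" using l(2)[rule_format, of 0] by (simp del: sublattices.simps)
        show "n \<le> N" by (rule that)
      qed (use l(2) partial_prod_nth_0 Q0 in auto)
    qed
    then show "\<forall>\<^sub>F N in sequentially. partial_prod k N $ n = Q $ n"
      by (auto simp: eventually_sequentially)
  qed
  then show ?thesis using Q0 dQ by blast
qed

section \<open>Orbits of commuting permutations\<close>

text \<open>Phrased through forward-stable subsets instead of the generated group. For permutations
  of a finite set the two agree, as a stable subset is mapped onto itself. Stability of
  \<open>I\<close> itself is assumed separately where orbits are compared.\<close>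

definition transitive_on :: "('i \<Rightarrow> 'i) set \<Rightarrow> 'i set \<Rightarrow> bool" where
  "transitive_on B I \<longleftrightarrow> I \<noteq> {} \<and> (\<forall>J\<subseteq>I. J \<noteq> {} \<longrightarrow> (\<forall>f\<in>B. f ` J \<subseteq> J) \<longrightarrow> J = I)"

lemma transitive_onD:
  assumes "transitive_on B I" "J \<subseteq> I" "J \<noteq> {}" "\<And>f. f \<in> B \<Longrightarrow> f ` J \<subseteq> J"
  shows "J = I"
  using assms unfolding transitive_on_def by blast

text \<open>A \<open>C\<close>-stable subset of \<open>I\<close> is also \<open>B\<close>-stable,
  because only values on \<open>I\<close> enter. This passes transitivity between maps on a large
  set and their restrictions to an orbit.\<close>

lemma transitive_on_cong:
  assumes "transitive_on B I" "\<And>f. f \<in> B \<Longrightarrow> \<exists>g\<in>C. \<forall>i\<in>I. g i = f i"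
  shows "transitive_on C I"
  unfolding transitive_on_def
proof (intro conjI allI impI)
  show "I \<noteq> {}" using assms(1) by (simp add: transitive_on_def)
  fix J assume J: "J \<subseteq> I" "J \<noteq> {}" "\<forall>f\<in>C. f ` J \<subseteq> J"
  show "J = I"
  proof (rule transitive_onD[OF assms(1) J(1,2)])
    fix f assume "f \<in> B"
    then obtain g where g: "g \<in> C" "\<forall>i\<in>I. g i = f i" using assms(2) by blast
    then have "f ` J = g ` J" using J(1) by (auto simp: image_iff subset_iff)
    then show "f ` J \<subseteq> J" using J(3) g(1) by simp
  qed
qed

text \<open>The intersection is a nonempty stable subset of both. The injectivity arguments below
  use this to recover the orbit through \<open>i0\<close>.\<close>

lemma transitive_on_unique:
  assumes "transitive_on B J" "transitive_on B K" "J \<inter> K \<noteq> {}"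
    and "\<And>f. f \<in> B \<Longrightarrow> f ` J \<subseteq> J" "\<And>f. f \<in> B \<Longrightarrow> f ` K \<subseteq> K"
  shows "J = K"
proof -
  have st: "f ` (J \<inter> K) \<subseteq> J \<inter> K" if "f \<in> B" for f
    using assms(4,5)[OF that] by blast
  have "J \<inter> K = J" using assms(1,3) st by (intro transitive_onD[OF assms(1)]) auto
  moreover have "J \<inter> K = K" using assms(2,3) st by (intro transitive_onD[OF assms(2)]) auto
  ultimately show ?thesis by simp
qed

text \<open>Take the smallest stable set \<open>U\<close> containing \<open>i0\<close>. A nonempty
  stable \<open>J\<close> inside \<open>U\<close> that misses \<open>i0\<close> is mapped onto
  itself, by finiteness and injectivity, so \<open>U - J\<close> would be a smaller stable set
  containing \<open>i0\<close>.\<close>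

lemma orbit_exists:
  assumes "finite I" "\<And>f. f \<in> B \<Longrightarrow> f permutes I" "i0 \<in> I"
  shows "\<exists>U. i0 \<in> U \<and> U \<subseteq> I \<and> (\<forall>f\<in>B. f ` U \<subseteq> U) \<and> transitive_on B U"
proof -
  define U where "U = \<Inter>{J. J \<subseteq> I \<and> i0 \<in> J \<and> (\<forall>f\<in>B. f ` J \<subseteq> J)}"
  have I: "I \<in> {J. J \<subseteq> I \<and> i0 \<in> J \<and> (\<forall>f\<in>B. f ` J \<subseteq> J)}"
    using assms(2,3) by (auto simp: permutes_in_image)
  have i0: "i0 \<in> U" and UI: "U \<subseteq> I" using I by (auto simp: U_def)
  have least: "U \<subseteq> J" if "J \<subseteq> I" "i0 \<in> J" "\<forall>f\<in>B. f ` J \<subseteq> J" for J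
    using that by (auto simp: U_def)
  have st: "f ` U \<subseteq> U" if f: "f \<in> B" for f
  proof
    fix y assume "y \<in> f ` U"
    then obtain u where u: "u \<in> U" "y = f u" by blast
    show "y \<in> U" unfolding U_def
    proof
      fix J assume J: "J \<in> {J. J \<subseteq> I \<and> i0 \<in> J \<and> (\<forall>f\<in>B. f ` J \<subseteq> J)}"
      then have "u \<in> J" using u(1) unfolding U_def by blast
      then show "y \<in> J" using J f u(2) by blast
    qed
  qed
  have "J = U" if J: "J \<subseteq> U" "J \<noteq> {}" "\<forall>f\<in>B. f ` J \<subseteq> J" for J
  proof (cases "i0 \<in> J")
    case True
    then show ?thesis using least[of J] J UI by blast
  next
    case False
    have "f ` (U - J) \<subseteq> U - J" if f: "f \<in> B" for f
    proof -
      have inj: "inj f" using assms(2)[OF f] by (rule permutes_inj)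
      have "finite J" by (rule finite_subset[OF subset_trans[OF J(1) UI] assms(1)])
      then have "f ` J = J"
        using J(3) f inj_on_subset[OF inj subset_UNIV] by (simp add: endo_inj_surj)
      then show ?thesis using st[OF f] inj by (metis Diff_mono image_set_diff order_refl)
    qed
    then have "U \<subseteq> U - J" using i0 False UI by (intro least) auto
    then show ?thesis using J by blast
  qed
  then have "transitive_on B U" using i0 by (auto simp: transitive_on_def)
  then show ?thesis using i0 UI st by (intro exI[of _ U]) auto
qed

lemma permutes_funpow: "s permutes I \<Longrightarrow> (s ^^ n) permutes I"
  by (induction n) (auto intro: permutes_compose simp: permutes_id)

lemma funpow_commute:
  assumes "s \<circ> f = f \<circ> s"
  shows "(s ^^ n) \<circ> f = f \<circ> (s ^^ n)"
proof (induction n)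
  case (Suc n)
  have "(s ^^ Suc n) \<circ> f = s \<circ> ((s ^^ n) \<circ> f)" by (simp only: funpow.simps comp_assoc)
  also have "\<dots> = (s \<circ> f) \<circ> (s ^^ n)" by (simp only: Suc comp_assoc)
  also have "\<dots> = f \<circ> (s ^^ Suc n)" by (simp only: assms funpow.simps comp_assoc)
  finally show ?case .
qed simp

text \<open>The points of \<open>U\<close> that \<open>s\<close> sends into a stable set are
  themselves stable, because \<open>s\<close> commutes with \<open>B\<close>.\<close>

lemma transitive_on_image:
  assumes "transitive_on B U" "\<And>f. f \<in> B \<Longrightarrow> f ` U \<subseteq> U" "\<And>f. f \<in> B \<Longrightarrow> s \<circ> f = f \<circ> s"
  shows "transitive_on B (s ` U)"
  unfolding transitive_on_def
proof (intro conjI allI impI)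
  show "s ` U \<noteq> {}" using assms(1) by (auto simp: transitive_on_def)
  fix J assume J: "J \<subseteq> s ` U" "J \<noteq> {}" "\<forall>f\<in>B. f ` J \<subseteq> J"
  have "{i\<in>U. s i \<in> J} = U"
  proof (rule transitive_onD[OF assms(1)])
    show "{i\<in>U. s i \<in> J} \<noteq> {}" using J by auto
    fix f assume f: "f \<in> B"
    have "s (f i) = f (s i)" for i using fun_cong[OF assms(3)[OF f], of i] by simp
    then show "f ` {i\<in>U. s i \<in> J} \<subseteq> {i\<in>U. s i \<in> J}" using assms(2)[OF f] J(3) f
      by (auto simp: image_subset_iff)
  qed auto
  then show "J = s ` U" using J(1) by auto
qed

text \<open>The translates of a \<open>B\<close>-orbit \<open>U\<close> under \<open>s\<close> are again \<open>B\<close>-orbits, and \<open>s\<close> permutes them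
  cyclically because \<open>s\<close> and \<open>B\<close> together act transitively.\<close>

lemma cyclic_orbit_decomposition:
  assumes fin: "finite I" and B: "\<And>f. f \<in> B \<Longrightarrow> f permutes I" and s: "s permutes I"
    and comm: "\<And>f. f \<in> B \<Longrightarrow> s \<circ> f = f \<circ> s" and i0: "i0 \<in> I"
    and tr: "transitive_on (insert s B) I"
  shows "\<exists>U m. i0 \<in> U \<and> U \<subseteq> I \<and> 0 < m \<and> (\<forall>f\<in>B. f ` U \<subseteq> U) \<and> transitive_on B U \<and>
     bij_betw (\<lambda>(u, i). (s ^^ i) u) (U \<times> {0..<m}) I \<and> (s ^^ m) ` U = U"
proof -
  obtain U where U: "i0 \<in> U" "U \<subseteq> I" "\<And>f. f \<in> B \<Longrightarrow> f ` U \<subseteq> U" "transitive_on B U"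
    using orbit_exists[OF fin, of B, OF B i0] by metis
  define T where "T n = (s ^^ n) ` U" for n
  have inj: "inj (s ^^ n)" for n using permutes_funpow[OF s] by (rule permutes_inj)
  have commn: "(s ^^ n) \<circ> f = f \<circ> (s ^^ n)" if "f \<in> B" for n f
    using funpow_commute comm[OF that] by blast
  have stT: "f ` T n \<subseteq> T n" if f: "f \<in> B" for f n
  proof -
    have "f ` T n = (s ^^ n) ` f ` U" unfolding T_def image_comp commn[OF f] ..
    then show ?thesis using U(3)[OF f] by (auto simp: T_def)
  qed
  have trT: "transitive_on B (T n)" for n
    unfolding T_def using U commn by (intro transitive_on_image) auto
  have TI: "T n \<subseteq> I" for n
    using U(2) permutes_in_image[OF permutes_funpow[OF s]] by (auto simp: T_def)
  have T_add: "T (a + b) = (s ^^ a) ` T b" for a b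
    by (simp add: T_def funpow_add image_comp)
  have T0: "T 0 = U" by (simp add: T_def)
  \<comment> \<open>Cancelling the injective map \<open>s ^^ a\<close> turns a repetition among the
    translates into a return to \<open>U\<close>.\<close>
  have diff: "T (b - a) = U" if "T a = T b" "a \<le> b" for a b
  proof -
    have "(s ^^ a) ` T (b - a) = (s ^^ a) ` T 0" using that T_add[of a "b - a"] T_add[of a 0] by simp
    then show ?thesis using inj[of a] T0 by (simp add: inj_image_eq_iff)
  qed
  have "range T \<subseteq> Pow I" using TI by auto
  then have "finite (range T)" by (rule finite_subset) (simp add: fin)
  then have "\<not> inj T" using finite_imageD[of T UNIV] infinite_UNIV_nat by auto
  then obtain a b where "a \<noteq> b" "T a = T b" by (auto simp: inj_def)
  then obtain c d where "c < d" "T c = T d" by (metis linorder_neqE_nat)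
  then have "T (d - c) = U" "0 < d - c" using diff by auto
  then have ex: "\<exists>m. 0 < m \<and> T m = U" by metis
  \<comment> \<open>The first return time of \<open>U\<close>. Minimality keeps \<open>T 0\<close>,
    ..., \<open>T (m - 1)\<close> distinct, and distinct orbits are disjoint.\<close>
  define m where "m = (LEAST m. 0 < m \<and> T m = U)"
  have m: "0 < m" "T m = U" using LeastI_ex[OF ex] by (auto simp: m_def)
  have m_least: "\<not> (0 < n \<and> T n = U)" if "n < m" for n
    using not_less_Least[of n "\<lambda>m. 0 < m \<and> T m = U"] that unfolding m_def .
  have disj: "T a \<inter> T b = {}" if "a < b" "b < m" for a b
  proof (rule ccontr)
    assume "T a \<inter> T b \<noteq> {}"
    then have "T a = T b" by (rule transitive_on_unique[OF trT trT _ stT stT])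
    then have "T (b - a) = U" using diff that by simp
    then show False using m_least[of "b - a"] that by linarith
  qed
  \<comment> \<open>The union is stable under \<open>B\<close>, since each translate is, and under
    \<open>s\<close>, since the last translate is carried back to \<open>U\<close>.\<close>
  have "(\<Union>i<m. T i) = I"
  proof (rule transitive_onD[OF tr])
    show "(\<Union>i<m. T i) \<subseteq> I" using TI by blast
    show "(\<Union>i<m. T i) \<noteq> {}" using m(1) U(1) T0 by auto
    fix f assume f: "f \<in> insert s B"
    show "f ` (\<Union>i<m. T i) \<subseteq> (\<Union>i<m. T i)"
    proof (cases "f \<in> B")
      case True
      then show ?thesis using stT by blast
    next
      case False
      then have fs: "f = s" using f by simp
      have "s ` T i \<subseteq> (\<Union>i<m. T i)" if "i < m" for i
      proof -
        have e: "s ` T i = T (Suc i)" using T_add[of 1 i] by simp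
        show ?thesis
        proof (cases "Suc i < m")
          case False
          then have "Suc i = m" using that by simp
          then have "s ` T i = T 0" using e m T0 by simp
          then show ?thesis using m(1) by auto
        qed (use e in auto)
      qed
      then show ?thesis using fs by blast
    qed
  qed
  moreover have "inj_on (\<lambda>(u, i). (s ^^ i) u) (U \<times> {0..<m})"
  proof (rule inj_onI, clarify)
    fix u i v j assume h: "u \<in> U" "i \<in> {0..<m}" "v \<in> U" "j \<in> {0..<m}" "(s ^^ i) u = (s ^^ j) v"
    have "(s ^^ i) u \<in> T i" "(s ^^ j) v \<in> T j" using h(1,3) by (auto simp: T_def)
    then have "(s ^^ i) u \<in> T i \<inter> T j" using h(5) by simp
    then have "i = j" using disj[of i j] disj[of j i] h by (metis atLeastLessThan_iff empty_iff inf_commute linorder_neqE_nat)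
    then show "u = v \<and> i = j" using h(5) inj by (auto dest: injD)
  qed
  moreover have "(\<lambda>(u, i). (s ^^ i) u) ` (U \<times> {0..<m}) = (\<Union>i<m. T i)"
    by (auto simp: T_def image_iff)
  ultimately have "bij_betw (\<lambda>(u, i). (s ^^ i) u) (U \<times> {0..<m}) I"
    by (simp add: bij_betw_def)
  then show ?thesis using U m by (intro exI[of _ U] exI[of _ m]) (auto simp: T_def)
qed

section \<open>Bundle automorphisms\<close>

definition bundle_map :: "('i \<Rightarrow> 'k) \<Rightarrow> ('i \<Rightarrow> 'a \<Rightarrow> 'a) \<Rightarrow> 'i \<times> 'a \<Rightarrow> 'k \<times> 'a" where
  "bundle_map s c = (\<lambda>(i, a). (s i, c i a))"

text \<open>The fibre point \<open>undefined\<close> is arbitrary: the base coordinate of a bundle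
  map does not depend on it.\<close>

definition base :: "('i \<times> 'a \<Rightarrow> 'k \<times> 'a) \<Rightarrow> 'i \<Rightarrow> 'k" where
  "base f i = fst (f (i, undefined))"

definition fibre :: "('i \<times> 'a \<Rightarrow> 'k \<times> 'a) \<Rightarrow> 'i \<Rightarrow> 'a \<Rightarrow> 'a" where
  "fibre f i a = snd (f (i, a))"

lemma bundle_map_apply [simp]: "bundle_map s c (i, a) = (s i, c i a)"
  by (simp add: bundle_map_def)

lemma base_bundle_map [simp]: "base (bundle_map s c) = s"
  by (simp add: base_def fun_eq_iff)

lemma fibre_bundle_map [simp]: "fibre (bundle_map s c) = c"
  by (simp add: fibre_def fun_eq_iff)

lemma base_id [simp]: "base id = id"
  by (simp add: base_def fun_eq_iff)

definition commuting_set :: "('e \<Rightarrow> 'e) set \<Rightarrow> bool" where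
  "commuting_set F \<longleftrightarrow> (\<forall>f\<in>F. \<forall>g\<in>F. f \<circ> g = g \<circ> f)"

lemma commuting_setD: "commuting_set F \<Longrightarrow> f \<in> F \<Longrightarrow> g \<in> F \<Longrightarrow> f \<circ> g = g \<circ> f"
  by (simp add: commuting_set_def)

lemma commuting_set_image:
  assumes "commuting_set F" "\<And>f g. f \<in> F \<Longrightarrow> g \<in> F \<Longrightarrow> h f \<circ> h g = h (f \<circ> g)"
  shows "commuting_set (h ` F)"
  using assms unfolding commuting_set_def by auto

text \<open>Continued by the identity, so that the restriction of an automorphism to a stable finite
  set is again a permutation of the whole space.\<close>

definition restr :: "'i set \<Rightarrow> ('i \<times> 'a \<Rightarrow> 'i \<times> 'a) \<Rightarrow> 'i \<times> 'a \<Rightarrow> 'i \<times> 'a" where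
  "restr J f e = (if fst e \<in> J then f e else e)"

lemma restr_apply [simp]: "restr J f (i, a) = (if i \<in> J then f (i, a) else (i, a))"
  by (simp add: restr_def)

lemma base_restr: "base (restr J f) i = (if i \<in> J then base f i else i)"
  by (simp add: base_def)

text \<open>The monoid generated by \<open>F\<close>. No inverses are adjoined, because
  \<open>transitive_on\<close> is phrased through forward-stable sets and positive words already
  reach every point.\<close>

inductive_set words :: "('e \<Rightarrow> 'e) set \<Rightarrow> ('e \<Rightarrow> 'e) set" for F where
  words_id: "id \<in> words F"
| words_comp: "f \<in> F \<Longrightarrow> w \<in> words F \<Longrightarrow> f \<circ> w \<in> words F"

lemma words_commute:
  assumes "w \<in> words F" "\<And>f. f \<in> F \<Longrightarrow> z \<circ> f = f \<circ> z"
  shows "z \<circ> w = w \<circ> z"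
  using assms(1)
proof induction
  case (words_comp f w)
  have "z \<circ> (f \<circ> w) = (z \<circ> f) \<circ> w" by (simp only: comp_assoc)
  also have "\<dots> = f \<circ> (z \<circ> w)" by (simp only: assms(2)[OF words_comp(1)] comp_assoc)
  finally show ?case by (simp only: words_comp comp_assoc)
qed simp

text \<open>The data of a bundle isomorphism from \<open>K\<close> to \<open>J\<close> with fibre
  maps in \<open>L\<close>. Both components are extensional on \<open>K\<close>, so that they can be
  counted.\<close>

definition labellings :: "('a \<Rightarrow> 'a) set \<Rightarrow> 'k set \<Rightarrow> 'i set \<Rightarrow> (('k \<Rightarrow> 'i) \<times> ('k \<Rightarrow> 'a \<Rightarrow> 'a)) set" where
  "labellings L K J = {s \<in> K \<rightarrow>\<^sub>E J. bij_betw s K J} \<times> (K \<rightarrow>\<^sub>E L)"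

text \<open>The conjugate P f P^-1 along the bundle isomorphism P given by \<open>s\<close> and
  \<open>c\<close>, continued by the identity outside its image.\<close>

definition conj_map :: "('k \<Rightarrow> 'i) \<Rightarrow> ('k \<Rightarrow> 'a \<Rightarrow> 'a) \<Rightarrow> 'k set \<Rightarrow> ('k \<times> 'a \<Rightarrow> 'k \<times> 'a) \<Rightarrow> 'i \<times> 'a \<Rightarrow> 'i \<times> 'a" where
  "conj_map s c K f e = (if fst e \<in> s ` K
     then bundle_map s c (f (inv_into (K \<times> UNIV) (bundle_map s c) e)) else e)"

text \<open>The diagonal action of \<open>f\<close> on \<open>m\<close> copies of its bundle; the
  second base coordinate numbers the copies.\<close>

definition lift :: "nat \<Rightarrow> ('i \<times> 'a \<Rightarrow> 'i \<times> 'a) \<Rightarrow> ('i \<times> nat) \<times> 'a \<Rightarrow> ('i \<times> nat) \<times> 'a" where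
  "lift m f = (\<lambda>((u, i), a). if i < m then ((fst (f (u, a)), i), snd (f (u, a))) else ((u, i), a))"

lemma lift_apply [simp]:
  "lift m f ((u, i), a) = (if i < m then ((fst (f (u, a)), i), snd (f (u, a))) else ((u, i), a))"
  by (simp add: lift_def)

text \<open>A cyclic shift through the \<open>m\<close> copies of \<open>U\<close> with monodromy
  \<open>z\<close> on the way back from the last copy to copy 0. Its \<open>m\<close>-th power is
  therefore \<open>z\<close> on copy 0.\<close>

definition shift :: "'i set \<Rightarrow> nat \<Rightarrow> ('i \<times> 'a \<Rightarrow> 'i \<times> 'a) \<Rightarrow> ('i \<times> nat) \<times> 'a \<Rightarrow> ('i \<times> nat) \<times> 'a" where
  "shift U m z = (\<lambda>((u, i), a). if u \<in> U \<and> i < m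
     then if Suc i < m then ((u, Suc i), a) else ((fst (z (u, a)), 0), snd (z (u, a)))
     else ((u, i), a))"

lemma shift_apply [simp]:
  "shift U m z ((u, i), a) = (if u \<in> U \<and> i < m
     then if Suc i < m then ((u, Suc i), a) else ((fst (z (u, a)), 0), snd (z (u, a)))
     else ((u, i), a))"
  by (simp add: shift_def)

lemma lift_comp: "lift m f \<circ> lift m g = lift m (f \<circ> g)"
  by (auto simp: fun_eq_iff)

section \<open>Automorphism groups of trivial bundles\<close>

locale bij_group =
  fixes L :: "('a \<Rightarrow> 'a) set"
  assumes finite_L: "finite L" and id_L: "id \<in> L"
    and comp_L: "f \<in> L \<Longrightarrow> g \<in> L \<Longrightarrow> f \<circ> g \<in> L"
    and inverse_L: "f \<in> L \<Longrightarrow> \<exists>g\<in>L. g \<circ> f = id \<and> f \<circ> g = id"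
begin

lemma bij_L: "f \<in> L \<Longrightarrow> bij f"
  using inverse_L o_bij by metis

text \<open>A model of the wreath product of \<open>L\<close> with the symmetric group of
  \<open>I\<close>. Being the identity outside \<open>I\<close>, automorphisms over disjoint or
  nested sets can be composed without any embedding.\<close>

definition aut :: "'i set \<Rightarrow> ('i \<times> 'a \<Rightarrow> 'i \<times> 'a) set" where
  "aut I = {bundle_map s c |s c. s permutes I \<and> (\<forall>i\<in>I. c i \<in> L) \<and> (\<forall>i. i \<notin> I \<longrightarrow> c i = id)}"

lemma autE:
  assumes "f \<in> aut I"
  obtains s c where "f = bundle_map s c" "s permutes I" "\<And>i. i \<in> I \<Longrightarrow> c i \<in> L" "\<And>i. i \<notin> I \<Longrightarrow> c i = id"
  using assms unfolding aut_def by auto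

lemma autI:
  assumes "\<And>i a. i \<in> I \<Longrightarrow> f (i, a) = (s i, c i a)" "\<And>i a. i \<notin> I \<Longrightarrow> f (i, a) = (i, a)"
    and "bij_betw s I I" "\<And>i. i \<in> I \<Longrightarrow> c i \<in> L"
  shows "f \<in> aut I"
proof -
  let ?s = "\<lambda>i. if i \<in> I then s i else i" and ?c = "\<lambda>i. if i \<in> I then c i else id"
  have "f = bundle_map ?s ?c" using assms(1,2) by (auto simp: fun_eq_iff bundle_map_def)
  moreover have "bij_betw ?s I I" using assms(3) by (simp cong: bij_betw_cong)
  then have "?s permutes I" by (rule bij_imp_permutes) simp
  ultimately show ?thesis unfolding aut_def mem_Collect_eq using assms(4)
    by (intro exI[of _ ?s] exI[of _ ?c]) simp
qed

lemma aut_apply: "f \<in> aut I \<Longrightarrow> f (i, a) = (base f i, fibre f i a)"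
  by (erule autE) simp

lemma aut_outside: "f \<in> aut I \<Longrightarrow> i \<notin> I \<Longrightarrow> f (i, a) = (i, a)"
  by (erule autE) (simp add: permutes_not_in)

lemma base_permutes: "f \<in> aut I \<Longrightarrow> base f permutes I"
  by (erule autE) simp

lemma fibre_L: "f \<in> aut I \<Longrightarrow> i \<in> I \<Longrightarrow> fibre f i \<in> L"
  by (erule autE) simp

lemma fibre_outside: "f \<in> aut I \<Longrightarrow> i \<notin> I \<Longrightarrow> fibre f i = id"
  by (erule autE) simp

lemma base_in: "f \<in> aut I \<Longrightarrow> i \<in> I \<Longrightarrow> base f i \<in> I"
  using base_permutes permutes_in_image by metis

lemma base_comp: "f \<in> aut I \<Longrightarrow> base (f \<circ> g) = base f \<circ> base g"
proof
  fix i assume f: "f \<in> aut I"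
  show "base (f \<circ> g) i = (base f \<circ> base g) i"
    using aut_apply[OF f, of "fst (g (i, undefined))" "snd (g (i, undefined))"] by (simp add: base_def)
qed

lemma base_commute:
  assumes "f \<in> aut I" "g \<in> aut I" "f \<circ> g = g \<circ> f"
  shows "base f \<circ> base g = base g \<circ> base f"
  using base_comp[OF assms(1), of g] base_comp[OF assms(2), of f] assms(3) by simp

lemma id_aut: "id \<in> aut I"
  unfolding aut_def using id_L
  by (auto intro!: exI[of _ id] exI[of _ "\<lambda>_. id"] simp: fun_eq_iff permutes_id)

lemma comp_aut:
  assumes "f \<in> aut I" "g \<in> aut I"
  shows "f \<circ> g \<in> aut I"
proof (rule autI[where s = "base f \<circ> base g" and c = "\<lambda>i. fibre f (base g i) \<circ> fibre g i"])
  show "bij_betw (base f \<circ> base g) I I"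
    using assms base_permutes permutes_compose permutes_imp_bij by metis
  show "fibre f (base g i) \<circ> fibre g i \<in> L" if "i \<in> I" for i
    using assms that base_in fibre_L comp_L by metis
qed (use assms aut_outside in \<open>auto simp: aut_apply[OF assms(1)] aut_apply[OF assms(2)]
      permutes_not_in[OF base_permutes] fibre_outside\<close>)

lemma inverse_aut:
  assumes "f \<in> aut I"
  obtains g where "g \<in> aut I" "g \<circ> f = id" "f \<circ> g = id"
proof -
  obtain s c where f: "f = bundle_map s c" "s permutes I" "\<And>i. i \<in> I \<Longrightarrow> c i \<in> L" "\<And>i. i \<notin> I \<Longrightarrow> c i = id"
    using autE[OF assms] by metis
  have "\<exists>d. d \<circ> c i = id \<and> c i \<circ> d = id \<and> (i \<in> I \<longrightarrow> d \<in> L) \<and> (i \<notin> I \<longrightarrow> d = id)" for i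
    using inverse_L[OF f(3)] f(4)[of i] by (cases "i \<in> I") auto
  then obtain d where d: "\<And>i. d i \<circ> c i = id" "\<And>i. c i \<circ> d i = id"
    "\<And>i. i \<in> I \<Longrightarrow> d i \<in> L" "\<And>i. i \<notin> I \<Longrightarrow> d i = id" by metis
  let ?t = "inv_into UNIV s"
  note ps = permutes_inverses[OF f(2)] and t = permutes_inv[OF f(2)]
  \<comment> \<open>Over i the inverse undoes \<open>c\<close> at the preimage of i.\<close>
  define g where "g = bundle_map ?t (\<lambda>i. d (?t i))"
  have "g \<in> aut I" unfolding aut_def g_def
    using d t by (auto simp: permutes_in_image[OF t] intro!: exI[of _ ?t] exI[of _ "\<lambda>i. d (?t i)"])
  moreover have "g \<circ> f = id" "f \<circ> g = id"
    using ps fun_cong[OF d(1)] fun_cong[OF d(2)] by (auto simp: fun_eq_iff g_def f(1))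
  ultimately show ?thesis using that by metis
qed

lemma bij_aut: "f \<in> aut I \<Longrightarrow> bij f"
  using inverse_aut o_bij by metis

lemma funpow_aut: "f \<in> aut I \<Longrightarrow> f ^^ n \<in> aut I"
  by (induction n) (simp_all add: id_aut[unfolded id_def] id_aut comp_aut)

lemma base_funpow: "f \<in> aut I \<Longrightarrow> base (f ^^ n) = base f ^^ n"
  by (induction n) (simp_all add: base_comp)

lemma aut_eqI:
  assumes "f \<in> aut I" "g \<in> aut I" "\<And>i a. i \<in> I \<Longrightarrow> f (i, a) = g (i, a)"
  shows "f = g"
proof
  fix e :: "'b \<times> 'a"
  show "f e = g e"
    using assms(3) aut_outside[OF assms(1)] aut_outside[OF assms(2)] by (cases e; cases "fst e \<in> I") auto
qed

lemma finite_aut: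
  assumes "finite I"
  shows "finite (aut I)"
proof (rule finite_subset)
  show "aut I \<subseteq> (\<lambda>(s, c). bundle_map s (\<lambda>i. if i \<in> I then c i else id)) ` ({s. s permutes I} \<times> (I \<rightarrow>\<^sub>E L))"
  proof
    fix f assume "f \<in> aut I"
    then obtain s c where f: "f = bundle_map s c" "s permutes I" "\<And>i. i \<in> I \<Longrightarrow> c i \<in> L" "\<And>i. i \<notin> I \<Longrightarrow> c i = id"
      using autE by metis
    have "c = (\<lambda>i. if i \<in> I then restrict c I i else id)" using f(4) by auto
    then have "f = (\<lambda>(s, c). bundle_map s (\<lambda>i. if i \<in> I then c i else id)) (s, restrict c I)" using f(1) by simp
    moreover have "(s, restrict c I) \<in> {s. s permutes I} \<times> (I \<rightarrow>\<^sub>E L)" using f by auto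
    ultimately show "f \<in> (\<lambda>(s, c). bundle_map s (\<lambda>i. if i \<in> I then c i else id)) ` ({s. s permutes I} \<times> (I \<rightarrow>\<^sub>E L))"
      by (rule image_eqI)
  qed
  show "finite ((\<lambda>(s, c). bundle_map s (\<lambda>i. if i \<in> I then c i else id)) ` ({s. s permutes I} \<times> (I \<rightarrow>\<^sub>E L)))"
    using assms finite_L by (intro finite_imageI finite_cartesian_product finite_PiE finite_permutations) auto
qed

text \<open>Finiteness makes the injective base map carry the stable set \<open>J\<close> onto
  itself.\<close>

lemma restr_aut:
  assumes "finite I" "f \<in> aut I" "J \<subseteq> I" "base f ` J \<subseteq> J"
  shows "restr J f \<in> aut J"
proof (rule autI[where s = "base f" and c = "fibre f"])
  have "inj_on (base f) J"
    using permutes_inj[OF base_permutes[OF assms(2)]] inj_on_subset subset_UNIV by metis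
  moreover have "finite J" using assms(1,3) finite_subset by metis
  ultimately show "bij_betw (base f) J J"
    using assms(4) endo_inj_surj bij_betw_def by metis
qed (use assms in \<open>auto simp: aut_apply fibre_L\<close>)

lemma restr_comp:
  assumes "g \<in> aut I" "base g ` J \<subseteq> J"
  shows "restr J f \<circ> restr J g = restr J (f \<circ> g)"
proof
  fix e :: "'b \<times> 'a"
  obtain i a where e: "e = (i, a)" by fastforce
  show "(restr J f \<circ> restr J g) e = restr J (f \<circ> g) e"
    using assms by (auto simp: e aut_apply)
qed

lemma words_aut:
  assumes "w \<in> words F" "F \<subseteq> aut I"
  shows "w \<in> aut I"
  using assms(1)
proof induction
  case words_id
  show ?case by (rule id_aut)
next
  case (words_comp f w)
  then show ?case using assms(2) by (intro comp_aut) auto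
qed

text \<open>The points that words reach from \<open>i0\<close> form a nonempty stable set.\<close>

lemma words_reach:
  assumes "F \<subseteq> aut I" "transitive_on (base ` F) I" "i0 \<in> I" "i \<in> I"
  shows "\<exists>w\<in>words F. base w i0 = i"
proof -
  let ?J = "(\<lambda>w. base w i0) ` words F"
  have "?J = I"
  proof (rule transitive_onD[OF assms(2)])
    show "?J \<subseteq> I" using base_in[OF words_aut[OF _ assms(1)] assms(3)] by auto
    show "?J \<noteq> {}" using words_id by auto
    fix g assume "g \<in> base ` F"
    then obtain f where f: "f \<in> F" "g = base f" by auto
    have "base f (base w i0) \<in> ?J" if "w \<in> words F" for w
    proof (rule image_eqI)
      show "base f (base w i0) = base (f \<circ> w) i0" using f(1) assms(1) base_comp[of f I w] by auto
      show "f \<circ> w \<in> words F" using f(1) that by (rule words_comp)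
    qed
    then show "g ` ?J \<subseteq> ?J" using f(2) by auto
  qed
  then show ?thesis using assms(4) by (metis imageE)
qed

text \<open>As \<open>y\<close> commutes with \<open>F\<close>, the fixed points of its base form a
  stable set, so a single fixed point forces all of \<open>I\<close> to be fixed.\<close>

lemma base_eq_id:
  assumes "y \<in> aut I" "F \<subseteq> aut I" "transitive_on (base ` F) I" "\<And>f. f \<in> F \<Longrightarrow> y \<circ> f = f \<circ> y"
    and "i0 \<in> I" "base y i0 = i0"
  shows "base y = id"
proof -
  have "{i\<in>I. base y i = i} = I"
  proof (rule transitive_onD[OF assms(3)])
    show "{i\<in>I. base y i = i} \<noteq> {}" using assms(5,6) by auto
    fix g assume "g \<in> base ` F"
    then obtain f where f: "f \<in> F" "g = base f" by auto
    then have fI: "f \<in> aut I" using assms(2) by auto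
    have "base y (base f i) = base f (base y i)" for i
      using fun_cong[OF base_commute[OF assms(1) fI assms(4)[OF f(1)]], of i] by simp
    then show "g ` {i\<in>I. base y i = i} \<subseteq> {i\<in>I. base y i = i}"
      using f(2) base_in[OF fI] by auto
  qed auto
  then have "base y i = i" for i
    using permutes_not_in[OF base_permutes[OF assms(1)]] by (cases "i \<in> I") auto
  then show ?thesis by auto
qed

section \<open>Transport along a bundle isomorphism\<close>

context
  fixes s :: "'k \<Rightarrow> 'i" and c :: "'k \<Rightarrow> 'a \<Rightarrow> 'a" and K :: "'k set" and I :: "'i set"
  assumes s: "bij_betw s K I" and c: "\<And>k. k \<in> K \<Longrightarrow> c k \<in> L"
begin

lemma conj_map_apply:
  assumes "k \<in> K"
  shows "conj_map s c K f (bundle_map s c (k, a)) = bundle_map s c (f (k, a))"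
proof -
  have "inj_on (bundle_map s c) (K \<times> UNIV)"
  proof (rule inj_onI, clarify)
    fix k a l b assume h: "k \<in> K" "l \<in> K" "bundle_map s c (k, a) = bundle_map s c (l, b)"
    then have "k = l" using s by (auto simp: bij_betw_def dest: inj_onD)
    then show "k = l \<and> a = b" using h bij_is_inj[OF bij_L[OF c[OF h(1)]]] by (auto dest: injD)
  qed
  then have "inv_into (K \<times> UNIV) (bundle_map s c) (bundle_map s c (k, a)) = (k, a)"
    using assms by (intro inv_into_f_f) auto
  then show ?thesis using assms by (simp add: conj_map_def)
qed

lemma conj_map_aut:
  assumes f: "f \<in> aut K"
  shows "conj_map s c K f \<in> aut I"
proof -
  have "\<exists>d\<in>L. d \<circ> c k = id \<and> c k \<circ> d = id" if "k \<in> K" for k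
    using inverse_L[OF c[OF that]] .
  then obtain d where d: "\<And>k. k \<in> K \<Longrightarrow> d k \<in> L" "\<And>k. k \<in> K \<Longrightarrow> c k \<circ> d k = id" by metis
  define t where "t = inv_into K s"
  have t: "t i \<in> K" "s (t i) = i" if "i \<in> I" for i
    using that s bij_betw_inv_into_right[OF s that] bij_betw_apply[OF bij_betw_inv_into[OF s]]
    by (auto simp: t_def)
  show ?thesis
  proof (rule autI[where s = "s \<circ> (base f \<circ> t)" and c = "\<lambda>i. c (base f (t i)) \<circ> (fibre f (t i) \<circ> d (t i))"])
    fix i a assume i: "i \<in> I"
    have e: "(i, a) = bundle_map s c (t i, d (t i) a)"
      using t[OF i] fun_cong[OF d(2)[OF t(1)[OF i]], of a] by simp
    show "conj_map s c K f (i, a) =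
        ((s \<circ> (base f \<circ> t)) i, (c (base f (t i)) \<circ> (fibre f (t i) \<circ> d (t i))) a)"
      unfolding e using t[OF i] by (subst conj_map_apply) (simp_all add: aut_apply[OF f])
    show "c (base f (t i)) \<circ> (fibre f (t i) \<circ> d (t i)) \<in> L"
      using t[OF i] base_in[OF f] fibre_L[OF f] by (intro comp_L c d(1)) auto
  next
    fix i a assume "i \<notin> I"
    then have "i \<notin> s ` K" using s by (simp add: bij_betw_def)
    then show "conj_map s c K f (i, a) = (i, a)" by (simp add: conj_map_def)
  next
    have "bij_betw (base f) K K" using base_permutes[OF f] by (rule permutes_imp_bij)
    then show "bij_betw (s \<circ> (base f \<circ> t)) I I"
      unfolding t_def using s bij_betw_inv_into[OF s] by (intro bij_betw_trans) auto
  qed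
qed

text \<open>Every point over \<open>I\<close> lies in the image of the isomorphism, so the
  intertwining relation determines \<open>g\<close>. Later identities between transported maps are
  checked through this relation.\<close>

lemma conj_map_unique:
  assumes "g \<in> aut I" "f \<in> aut K" "\<And>k a. k \<in> K \<Longrightarrow> g (bundle_map s c (k, a)) = bundle_map s c (f (k, a))"
  shows "g = conj_map s c K f"
proof (rule aut_eqI[OF assms(1) conj_map_aut[OF assms(2)]])
  fix i a assume "i \<in> I"
  then obtain k where k: "k \<in> K" "i = s k" using s by (auto simp: bij_betw_def)
  obtain b where b: "a = c k b" using bij_is_surj[OF bij_L[OF c[OF k(1)]]] by (metis surj_def)
  have "(i, a) = bundle_map s c (k, b)" using k b by simp
  then show "g (i, a) = conj_map s c K f (i, a)"
    using assms(3)[OF k(1)] conj_map_apply[OF k(1)] by metis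
qed

lemma conj_map_comp:
  assumes "f \<in> aut K" "g \<in> aut K"
  shows "conj_map s c K f \<circ> conj_map s c K g = conj_map s c K (f \<circ> g)"
proof (rule conj_map_unique)
  show "conj_map s c K f \<circ> conj_map s c K g \<in> aut I" using assms by (intro comp_aut conj_map_aut)
  show "f \<circ> g \<in> aut K" using assms by (rule comp_aut)
  fix k a assume k: "k \<in> K"
  have "g (k, a) = (base g k, fibre g k a)" "base g k \<in> K"
    using aut_apply[OF assms(2)] base_in[OF assms(2) k] by auto
  then show "(conj_map s c K f \<circ> conj_map s c K g) (bundle_map s c (k, a)) = bundle_map s c ((f \<circ> g) (k, a))"
    using conj_map_apply[OF k, of g a] conj_map_apply[of "base g k" f "fibre g k a"] by (simp del: bundle_map_apply)
qed

lemma base_conj_map: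
  assumes "f \<in> aut K" "k \<in> K"
  shows "base (conj_map s c K f) (s k) = s (base f k)"
proof -
  have "conj_map s c K f (s k, c k undefined) = (s (base f k), c (base f k) (fibre f k undefined))"
    using conj_map_apply[OF assms(2), of f undefined] by (simp add: aut_apply[OF assms(1)])
  then show ?thesis using aut_apply[OF conj_map_aut[OF assms(1)]] by simp
qed

text \<open>Pulling a stable set back along \<open>s\<close> gives a stable subset of
  \<open>K\<close>.\<close>

lemma transitive_on_conj_map:
  assumes "F \<subseteq> aut K" "transitive_on (base ` F) K"
  shows "transitive_on (base ` conj_map s c K ` F) I"
  unfolding transitive_on_def
proof (intro conjI allI impI)
  have sK: "s ` K = I" using s by (simp add: bij_betw_def)
  show "I \<noteq> {}" using assms(2) sK by (auto simp: transitive_on_def)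
  fix J assume J: "J \<subseteq> I" "J \<noteq> {}" "\<forall>f\<in>base ` conj_map s c K ` F. f ` J \<subseteq> J"
  have "{k\<in>K. s k \<in> J} = K"
  proof (rule transitive_onD[OF assms(2)])
    show "{k\<in>K. s k \<in> J} \<noteq> {}" using J sK by auto
    fix g assume "g \<in> base ` F"
    then obtain f where f: "f \<in> F" "g = base f" by auto
    have fK: "f \<in> aut K" using f assms(1) by auto
    have "base f k \<in> K \<and> s (base f k) \<in> J" if k: "k \<in> K" "s k \<in> J" for k
    proof -
      have "base (conj_map s c K f) (s k) \<in> J" using J(3) f(1) k(2) by auto
      then show ?thesis using base_conj_map[OF fK k(1)] base_in[OF fK k(1)] by simp
    qed
    then show "g ` {k\<in>K. s k \<in> J} \<subseteq> {k\<in>K. s k \<in> J}" using f(2) by auto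
  qed auto
  then show "J = I" using J(1) sK by auto
qed

lemma base_conj_map_eq_id:
  assumes "f \<in> aut K" "base f = id"
  shows "base (conj_map s c K f) = id"
proof
  fix i
  show "base (conj_map s c K f) i = id i"
  proof (cases "i \<in> I")
    case True
    then obtain k where "k \<in> K" "i = s k" using s by (auto simp: bij_betw_def)
    then show ?thesis using base_conj_map[OF assms(1)] assms(2) by simp
  next
    case False
    then show ?thesis using permutes_not_in[OF base_permutes[OF conj_map_aut[OF assms(1)]]] by simp
  qed
qed

end

section \<open>Actions on several copies of an orbit\<close>

lemma lift_aut:
  assumes f: "f \<in> aut U"
  shows "lift m f \<in> aut (U \<times> {0..<m})"
proof (rule autI[where s = "map_prod (base f) id" and c = "\<lambda>k. fibre f (fst k)"])
  show "bij_betw (map_prod (base f) id) (U \<times> {0..<m}) (U \<times> {0..<m})"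
    using permutes_imp_bij[OF base_permutes[OF f]] by (intro bij_betw_map_prod) auto
  show "lift m f (k, a) = (k, a)" if "k \<notin> U \<times> {0..<m}" for k a
    using that by (cases k) (auto simp: aut_outside[OF f])
  show "lift m f (k, a) = (map_prod (base f) id k, fibre f (fst k) a)" if "k \<in> U \<times> {0..<m}" for k a
    using that by (cases k) (auto simp: aut_apply[OF f])
  show "fibre f (fst k) \<in> L" if "k \<in> U \<times> {0..<m}" for k
    using that by (auto simp: fibre_L[OF f])
qed

lemma base_lift: "f \<in> aut U \<Longrightarrow> i < m \<Longrightarrow> base (lift m f) (u, i) = (base f u, i)"
  by (simp add: base_def)

lemma base_lift_eq_id: "base f = id \<Longrightarrow> base (lift m f) = id"
  by (auto simp: fun_eq_iff base_def)

lemma base_shift: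
  "u \<in> U \<Longrightarrow> i < m \<Longrightarrow> base (shift U m z) (u, i) = (if Suc i < m then (u, Suc i) else (base z u, 0))"
  by (simp add: base_def)

lemma shift_aut:
  assumes z: "z \<in> aut U" and fin: "finite U"
  shows "shift U m z \<in> aut (U \<times> {0..<m})"
proof (rule autI[where s = "\<lambda>(u, i). if Suc i < m then (u, Suc i) else (base z u, 0)"
      and c = "\<lambda>(u, i). if Suc i < m then id else fibre z u"])
  let ?s = "\<lambda>(u, i). if Suc i < m then (u, Suc i) else (base z u, 0)"
  have bz: "inj (base z)" using permutes_inj[OF base_permutes[OF z]] .
  have "inj_on ?s (U \<times> {0..<m})"
  proof (rule inj_onI, clarify)
    fix u i v j assume "u \<in> U" "v \<in> U" "i \<in> {0..<m}" "j \<in> {0..<m}"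
      "(if Suc i < m then (u, Suc i) else (base z u, 0)) = (if Suc j < m then (v, Suc j) else (base z v, 0))"
    then show "u = v \<and> i = j" using injD[OF bz, of u v] by (auto split: if_splits)
  qed
  moreover have "?s ` (U \<times> {0..<m}) \<subseteq> U \<times> {0..<m}"
    using base_in[OF z] by (auto split: if_splits)
  moreover have "finite (U \<times> {0..<m})" using fin by simp
  ultimately show "bij_betw ?s (U \<times> {0..<m}) (U \<times> {0..<m})"
    using endo_inj_surj[of "U \<times> {0..<m}" ?s] by (simp only: bij_betw_def)
  show "shift U m z (k, a) = (k, a)" if "k \<notin> U \<times> {0..<m}" for k a
    using that by (cases k) auto
  show "shift U m z (k, a) = (?s k, (case k of (u, i) \<Rightarrow> if Suc i < m then id else fibre z u) a)"
    if "k \<in> U \<times> {0..<m}" for k a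
    using that by (cases k) (auto simp: aut_apply[OF z])
  show "(case k of (u, i) \<Rightarrow> if Suc i < m then id else fibre z u) \<in> L" if "k \<in> U \<times> {0..<m}" for k
    using that id_L by (auto simp: fibre_L[OF z])
qed

text \<open>Between consecutive copies only the copy number changes, and \<open>lift\<close> treats
  all copies alike; on the return to copy 0 the relation between \<open>z\<close> and
  \<open>f\<close> is used.\<close>

lemma shift_lift_commute:
  assumes f: "f \<in> aut U" and z: "z \<in> aut U" and zf: "z \<circ> f = f \<circ> z" and fin: "finite U"
  shows "shift U m z \<circ> lift m f = lift m f \<circ> shift U m z"
proof (rule aut_eqI[of _ "U \<times> {0..<m}"])
  show "shift U m z \<circ> lift m f \<in> aut (U \<times> {0..<m})" "lift m f \<circ> shift U m z \<in> aut (U \<times> {0..<m})"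
    using f z fin by (simp_all only: comp_aut shift_aut lift_aut)
  fix k a assume "k \<in> U \<times> {0..<m}"
  then obtain u i where k: "k = (u, i)" "u \<in> U" "i < m" by auto
  have "z (f (u, a)) = f (z (u, a))" using fun_cong[OF zf, of "(u, a)"] by simp
  moreover have "fst (f (u, a)) \<in> U" using base_in[OF f k(2)] by (simp add: aut_apply[OF f])
  ultimately show "(shift U m z \<circ> lift m f) (k, a) = (lift m f \<circ> shift U m z) (k, a)"
    using k by auto
qed

text \<open>From any point of a stable set the shift leads to the last copy and then into copy 0.
  There \<open>F\<close> fills the whole copy, and shifting again fills the others.\<close>

lemma transitive_on_shift:
  assumes F: "F \<subseteq> aut U" "transitive_on (base ` F) U" and z: "z \<in> aut U" and m: "0 < m"
  shows "transitive_on (base ` insert (shift U m z) (lift m ` F)) (U \<times> {0..<m})"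
  unfolding transitive_on_def
proof (intro conjI allI impI)
  show "U \<times> {0..<m} \<noteq> {}" using F(2) m by (auto simp: transitive_on_def)
  fix J assume J: "J \<subseteq> U \<times> {0..<m}" "J \<noteq> {}"
    "\<forall>f\<in>base ` insert (shift U m z) (lift m ` F). f ` J \<subseteq> J"
  have sh: "(if Suc i < m then (u, Suc i) else (base z u, 0)) \<in> J" if "(u, i) \<in> J" for u i
  proof -
    have "base (shift U m z) (u, i) \<in> J" using J(3) that by auto
    then show ?thesis using base_shift[of u U i m z] that J(1) by auto
  qed
  obtain u i where ui: "(u, i) \<in> J" using J(2) by auto
  have "(u, i + n) \<in> J" if "i + n < m" for n
    using that
  proof (induction n)
    case (Suc n)
    then show ?case using sh[of u "i + n"] by simp
  qed (use ui in simp)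
  from this[of "m - 1 - i"] have "(u, m - 1) \<in> J" using J(1) ui by auto
  then have 0: "(base z u, 0) \<in> J" using sh[of u "m - 1"] m by simp
  have "{u\<in>U. (u, 0) \<in> J} = U"
  proof (rule transitive_onD[OF F(2)])
    show "{u\<in>U. (u, 0) \<in> J} \<noteq> {}" using 0 J(1) by auto
    fix g assume "g \<in> base ` F"
    then obtain f where f: "f \<in> F" "g = base f" by auto
    have fU: "f \<in> aut U" using f F(1) by auto
    have "base f v \<in> U \<and> (base f v, 0) \<in> J" if v: "v \<in> U" "(v, 0) \<in> J" for v
    proof -
      have "base (lift m f) (v, 0) \<in> J" using J(3) f(1) v(2) by auto
      then show ?thesis using base_lift[OF fU m] base_in[OF fU v(1)] by simp
    qed
    then show "g ` {u\<in>U. (u, 0) \<in> J} \<subseteq> {u\<in>U. (u, 0) \<in> J}" using f(2) by auto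
  qed auto
  then have z0: "(v, 0) \<in> J" if "v \<in> U" for v using that by auto
  have "(v, n) \<in> J" if "v \<in> U" "n < m" for v n
    using that(2)
  proof (induction n)
    case (Suc n)
    then show ?case using sh[of v n] by simp
  qed (use z0 that in simp)
  then show "J = U \<times> {0..<m}" using J(1) by auto
qed

text \<open>The maps in \<open>xs\<close> act transitively on the base; those in \<open>ys\<close>
  commute with them and fix every base point. The list \<open>ys\<close> collects what is left of
  generators already removed.\<close>

definition trans_tuples :: "nat \<Rightarrow> 'i set \<Rightarrow> nat \<Rightarrow> (('i \<times> 'a \<Rightarrow> 'i \<times> 'a) list \<times> ('i \<times> 'a \<Rightarrow> 'i \<times> 'a) list) set" where
  "trans_tuples j I l = {(xs, ys). length xs = j \<and> length ys = l \<and> set xs \<union> set ys \<subseteq> aut I \<and>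
     commuting_set (set xs \<union> set ys) \<and> transitive_on (base ` set xs) I \<and> (\<forall>y\<in>set ys. base y = id)}"

text \<open>Here \<open>z\<close> stands for the monodromy of a removed generator on one orbit; it
  centralises the rest but may move base points.\<close>

definition ext_tuples :: "nat \<Rightarrow> 'i set \<Rightarrow> nat \<Rightarrow> (('i \<times> 'a \<Rightarrow> 'i \<times> 'a) \<times> ('i \<times> 'a \<Rightarrow> 'i \<times> 'a) list \<times> ('i \<times> 'a \<Rightarrow> 'i \<times> 'a) list) set" where
  "ext_tuples j I l = {(z, xs, ys). z \<in> aut I \<and> (xs, ys) \<in> trans_tuples j I l \<and>
     (\<forall>f\<in>set xs \<union> set ys. z \<circ> f = f \<circ> z)}"

lemma finite_trans_tuples:
  assumes "finite I"
  shows "finite (trans_tuples j I l)"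
proof (rule finite_subset)
  let ?S = "\<lambda>n. {xs. set xs \<subseteq> aut I \<and> length xs = n}"
  show "trans_tuples j I l \<subseteq> ?S j \<times> ?S l" by (auto simp: trans_tuples_def)
  show "finite (?S j \<times> ?S l)" using finite_aut[OF assms] by (intro finite_cartesian_product finite_lists_length_eq)
qed

lemma trans_tuples_Suc:
  "(xs, y # ys) \<in> trans_tuples j I (Suc l) \<longleftrightarrow> (y, xs, ys) \<in> ext_tuples j I l \<and> base y = id"
  unfolding trans_tuples_def ext_tuples_def commuting_set_def by auto

text \<open>By transitivity some word w in \<open>xs\<close> moves \<open>i0\<close> to the same
  point i as \<open>z\<close>. As w commutes with everything in sight, so does y = w^-1 z; its base
  fixes \<open>i0\<close> and is therefore trivial. Thus \<open>z\<close> amounts to a free choice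
  of i in \<open>I\<close> and a further base-trivial element y.\<close>

lemma card_ext_tuples:
  fixes I :: "'i set"
  assumes fin: "finite I"
  shows "card (ext_tuples j I l) = card I * card (trans_tuples j I (Suc l))"
proof (cases "I = {}")
  case True
  then have "ext_tuples j I l = {}" by (auto simp: ext_tuples_def trans_tuples_def transitive_on_def)
  then show ?thesis using True by simp
next
  case False
  then obtain i0 where i0: "i0 \<in> I" by auto
  \<comment> \<open>The chosen word depends on \<open>xs\<close> and \<open>i\<close> only, so the
    same word serves to split \<open>z\<close> and to rebuild it.\<close>
  define w where "w xs i = (SOME w. w \<in> words (set xs) \<and> base w i0 = i)"
    for xs :: "('i \<times> 'a \<Rightarrow> 'i \<times> 'a) list" and i
  have w: "w xs i \<in> words (set xs)" "base (w xs i) i0 = i"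
    if "set xs \<subseteq> aut I" "transitive_on (base ` set xs) I" "i \<in> I" for xs i
    using someI_ex[of "\<lambda>w. w \<in> words (set xs) \<and> base w i0 = i"] words_reach[OF that(1,2) i0 that(3)]
    unfolding w_def by auto
  have w_comm: "f \<circ> w xs i = w xs i \<circ> f"
    if "set xs \<subseteq> aut I" "transitive_on (base ` set xs) I" "i \<in> I" "\<And>x. x \<in> set xs \<Longrightarrow> f \<circ> x = x \<circ> f" for xs i f
    using words_commute[OF w(1)[OF that(1-3)]] that(4) by metis
  \<comment> \<open>Rebuilds z = w y, with the base-trivial factor y stored at the head of
    \<open>ys\<close>.\<close>
  define \<Psi> where "\<Psi> = (\<lambda>(i, xs, ys :: ('i \<times> 'a \<Rightarrow> 'i \<times> 'a) list). (w xs i \<circ> hd ys, xs, tl ys))"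
  have "bij_betw \<Psi> (I \<times> trans_tuples j I (Suc l)) (ext_tuples j I l)"
  proof (rule bij_betw_imageI)
    have mem: "\<exists>y zs. ys = y # zs \<and> (y, xs, zs) \<in> ext_tuples j I l \<and> base y = id \<and> y \<in> aut I \<and>
        set xs \<subseteq> aut I \<and> set zs \<subseteq> aut I \<and> transitive_on (base ` set xs) I"
      if W: "(xs, ys) \<in> trans_tuples j I (Suc l)" for xs ys
    proof -
      obtain y zs where ys: "ys = y # zs" using W by (cases ys) (auto simp: trans_tuples_def)
      have "(y, xs, zs) \<in> ext_tuples j I l" "base y = id" using W unfolding ys trans_tuples_Suc by auto
      then show ?thesis using ys unfolding ext_tuples_def trans_tuples_def by auto
    qed
    show "inj_on \<Psi> (I \<times> trans_tuples j I (Suc l))"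
    proof (rule inj_onI)
      fix p q
      assume pq: "p \<in> I \<times> trans_tuples j I (Suc l)" "q \<in> I \<times> trans_tuples j I (Suc l)" "\<Psi> p = \<Psi> q"
      obtain i xs ys where p: "p = (i, xs, ys)" by (cases p)
      obtain i' xs' ys' where q: "q = (i', xs', ys')" by (cases q)
      have h: "i \<in> I" "i' \<in> I" "(xs, ys) \<in> trans_tuples j I (Suc l)" "(xs', ys') \<in> trans_tuples j I (Suc l)"
        "\<Psi> (i, xs, ys) = \<Psi> (i', xs', ys')" using pq p q by auto
      obtain y zs where y: "ys = y # zs" "base y = id" "y \<in> aut I" "set xs \<subseteq> aut I" "transitive_on (base ` set xs) I"
        using mem[OF h(3)] by metis
      obtain y' zs' where y': "ys' = y' # zs'" "base y' = id" "y' \<in> aut I"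
        using mem[OF h(4)] by metis
      have e: "w xs i \<circ> y = w xs i' \<circ> y'" "xs = xs'" "zs = zs'" using h(5) y(1) y'(1) by (auto simp: \<Psi>_def)
      have wi: "w xs i \<in> aut I" "w xs i' \<in> aut I" using words_aut[OF w(1) y(4)] y(4,5) h(1,2) by auto
      \<comment> \<open>The base-trivial factors drop out, and the value at \<open>i0\<close>
        returns the index i.\<close>
      have "base (w xs i) = base (w xs i')"
        using base_comp[OF wi(1), of y] base_comp[OF wi(2), of y'] e(1) y(2) y'(2) by simp
      then have ii: "i = i'" using w(2)[OF y(4,5)] h(1,2) by metis
      then have "y = y'" using e(1) bij_is_inj[OF bij_aut[OF wi(1)]] by (simp add: fun.inj_map_strong fun_eq_iff inj_eq)
      then show "p = q" using ii e y(1) y'(1) p q by simp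
    qed
    show "\<Psi> ` (I \<times> trans_tuples j I (Suc l)) = ext_tuples j I l"
    proof (intro equalityI subsetI)
      fix p assume "p \<in> \<Psi> ` (I \<times> trans_tuples j I (Suc l))"
      then obtain i xs ys where p: "i \<in> I" "(xs, ys) \<in> trans_tuples j I (Suc l)" "p = \<Psi> (i, xs, ys)" by auto
      obtain y zs where y: "ys = y # zs" "(y, xs, zs) \<in> ext_tuples j I l" "y \<in> aut I" "set xs \<subseteq> aut I"
        "transitive_on (base ` set xs) I" using mem[OF p(2)] by metis
      have W: "(xs, zs) \<in> trans_tuples j I l" using y(2) by (auto simp: ext_tuples_def)
      have "(w xs i \<circ> y) \<circ> f = f \<circ> (w xs i \<circ> y)" if f: "f \<in> set xs \<union> set zs" for f
      proof -
        have "f \<circ> x = x \<circ> f" if "x \<in> set xs" for x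
          using W f that by (auto simp: trans_tuples_def intro: commuting_setD)
        then have 1: "f \<circ> w xs i = w xs i \<circ> f" using w_comm[OF y(4,5) p(1)] by metis
        have 2: "y \<circ> f = f \<circ> y" using y(2) f by (auto simp: ext_tuples_def)
        show ?thesis by (metis 1 2 comp_assoc)
      qed
      then have "(w xs i \<circ> y, xs, zs) \<in> ext_tuples j I l"
        using W comp_aut[OF words_aut[OF w(1)[OF y(4,5) p(1)] y(4)] y(3)] unfolding ext_tuples_def by auto
      then show "p \<in> ext_tuples j I l" using p(3) y(1) by (simp add: \<Psi>_def)
    next
      fix p assume "p \<in> ext_tuples j I l"
      then obtain z xs ys where p: "p = (z, xs, ys)" "(z, xs, ys) \<in> ext_tuples j I l" by (cases p) auto
      have z: "z \<in> aut I" "(xs, ys) \<in> trans_tuples j I l" "\<And>f. f \<in> set xs \<union> set ys \<Longrightarrow> z \<circ> f = f \<circ> z"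
        using p(2) by (auto simp: ext_tuples_def)
      have xs: "set xs \<subseteq> aut I" "transitive_on (base ` set xs) I" "commuting_set (set xs \<union> set ys)"
        using z(2) by (auto simp: trans_tuples_def)
      define i where "i = base z i0"
      have i: "i \<in> I" using base_in[OF z(1) i0] by (simp add: i_def)
      have wI: "w xs i \<in> aut I" using words_aut[OF w(1)[OF xs(1,2) i] xs(1)] .
      obtain v where v: "v \<in> aut I" "v \<circ> w xs i = id" "w xs i \<circ> v = id" using inverse_aut[OF wI] by metis
      define y where "y = v \<circ> z"
      have yI: "y \<in> aut I" using v(1) z(1) by (simp only: y_def comp_aut)
      have yf: "y \<circ> f = f \<circ> y" if f: "f \<in> set xs \<union> set ys" for f
      proof -
        have "f \<circ> x = x \<circ> f" if "x \<in> set xs" for x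
          using xs(3) f that by (auto intro: commuting_setD)
        then have 1: "f \<circ> w xs i = w xs i \<circ> f" using w_comm[OF xs(1,2) i] by metis
        \<comment> \<open>A map commuting with the word also commutes with its inverse
          \<open>v\<close>.\<close>
        have "v \<circ> f = v \<circ> f \<circ> (w xs i \<circ> v)" using v(3) by simp
        also have "\<dots> = v \<circ> (f \<circ> w xs i) \<circ> v" by (simp only: comp_assoc)
        also have "\<dots> = (v \<circ> w xs i) \<circ> f \<circ> v" by (simp only: 1 comp_assoc)
        also have "\<dots> = f \<circ> v" using v(2) by simp
        finally have "v \<circ> f = f \<circ> v" .
        then show ?thesis using z(3)[OF f] unfolding y_def by (metis comp_assoc)
      qed
      have "base v \<circ> base (w xs i) = id" using base_comp[OF v(1), of "w xs i"] v(2) by simp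
      then have "base v i = i0" using w(2)[OF xs(1,2) i] by (metis comp_apply id_apply)
      then have "base y i0 = i0" using base_comp[OF v(1), of z] by (simp add: y_def i_def)
      then have "base y = id" using base_eq_id[OF yI xs(1,2) _ i0] yf by auto
      then have "(xs, y # ys) \<in> trans_tuples j I (Suc l)"
        unfolding trans_tuples_Suc using yI z(2) yf by (auto simp: ext_tuples_def)
      moreover have "w xs i \<circ> y = z" unfolding y_def comp_assoc[symmetric] v(3) by simp
      ultimately show "p \<in> \<Psi> ` (I \<times> trans_tuples j I (Suc l))"
        using i p(1) by (intro image_eqI[of _ _ "(i, xs, y # ys)"]) (auto simp: \<Psi>_def)
    qed
  qed
  then show ?thesis using bij_betw_same_card card_cartesian_product by metis
qed

end

section \<open>Unrolling a cyclically permuted orbit\<close>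

lemma card_labellings:
  assumes "finite K" "finite J" "card K = card J"
  shows "card (labellings L K J) = fact (card J) * card L ^ card J"
proof -
  have "{s \<in> K \<rightarrow>\<^sub>E J. bij_betw s K J} = {s \<in> K \<rightarrow>\<^sub>E J. inj_on s K}"
  proof (intro Collect_cong conj_cong refl iffI)
    fix s assume s: "s \<in> K \<rightarrow>\<^sub>E J" "inj_on s K"
    then have "s ` K \<subseteq> J" by auto
    moreover have "card (s ` K) = card J" using card_image[OF s(2)] assms(3) by simp
    ultimately have "s ` K = J" using assms(2) card_subset_eq by metis
    then show "bij_betw s K J" using s(2) by (simp add: bij_betw_def)
  qed (simp add: bij_betw_def)
  then have "card {s \<in> K \<rightarrow>\<^sub>E J. bij_betw s K J} = fact (card J)"
    using card_inj_on_subset_funcset[OF assms(1,2) order_refl] assms(3) by (simp add: fact_prod_rev)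
  moreover have "card (K \<rightarrow>\<^sub>E L) = card L ^ card J" using card_funcsetE[OF assms(1)] assms(3) by simp
  ultimately show ?thesis by (simp add: labellings_def card_cartesian_product)
qed

text \<open>Copy 0 is identified with \<open>U\<close> itself; only the copies from 1 on need a
  labelling. Without this normalisation the same action would arise from several labellings.\<close>

definition glue_base :: "('i \<times> nat \<Rightarrow> 'i) \<Rightarrow> 'i \<times> nat \<Rightarrow> 'i" where
  "glue_base s = (\<lambda>(u, i). if i = 0 then u else s (u, i))"

definition glue_fibre :: "('i \<times> nat \<Rightarrow> 'a \<Rightarrow> 'a) \<Rightarrow> 'i \<times> nat \<Rightarrow> 'a \<Rightarrow> 'a" where
  "glue_fibre c = (\<lambda>(u, i). if i = 0 then id else c (u, i))"

definition unroll :: "'i set \<Rightarrow> nat \<Rightarrow> ('i \<times> nat \<Rightarrow> 'i) \<times> ('i \<times> nat \<Rightarrow> 'a \<Rightarrow> 'a) \<Rightarrow>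
    (('i \<times> nat) \<times> 'a \<Rightarrow> ('i \<times> nat) \<times> 'a) \<Rightarrow> 'i \<times> 'a \<Rightarrow> 'i \<times> 'a" where
  "unroll U m = (\<lambda>(s, c). conj_map (glue_base s) (glue_fibre c) (U \<times> {0..<m}))"

text \<open>Rebuilds an action on all of \<open>I\<close> from one orbit: the transported shift is
  the new first generator, and the old generators act on every copy in the same way.\<close>

definition assemble :: "'i set \<Rightarrow> nat \<Rightarrow>
    (('i \<times> 'a \<Rightarrow> 'i \<times> 'a) \<times> ('i \<times> 'a \<Rightarrow> 'i \<times> 'a) list \<times> ('i \<times> 'a \<Rightarrow> 'i \<times> 'a) list) \<times>
    ('i \<times> nat \<Rightarrow> 'i) \<times> ('i \<times> nat \<Rightarrow> 'a \<Rightarrow> 'a) \<Rightarrow>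
    ('i \<times> 'a \<Rightarrow> 'i \<times> 'a) list \<times> ('i \<times> 'a \<Rightarrow> 'i \<times> 'a) list" where
  "assemble U m = (\<lambda>((z, xs, ys), p).
     (unroll U m p (shift U m z) # map (\<lambda>f. unroll U m p (lift m f)) xs,
      map (\<lambda>f. unroll U m p (lift m f)) ys))"

context bij_group begin

lemma glue_bij:
  assumes "(s, c) \<in> labellings L (U \<times> {1..<m}) (I - U)" "U \<subseteq> I" "0 < m"
  shows "bij_betw (glue_base s) (U \<times> {0..<m}) I"
    and "k \<in> U \<times> {0..<m} \<Longrightarrow> glue_fibre c k \<in> L"
proof -
  have "bij_betw (glue_base s) (U \<times> {0}) U"
    by (rule bij_betwI[where g = "\<lambda>u. (u, 0)"]) (auto simp: glue_base_def)
  moreover have "bij_betw s (U \<times> {1..<m}) (I - U)" using assms(1) by (auto simp: labellings_def)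
  then have "bij_betw (glue_base s) (U \<times> {1..<m}) (I - U)"
    by (subst bij_betw_cong[of _ _ s]) (auto simp: glue_base_def)
  ultimately have "bij_betw (glue_base s) (U \<times> {0} \<union> U \<times> {1..<m}) (U \<union> (I - U))"
    by (rule bij_betw_combine) auto
  moreover have "U \<times> {0} \<union> U \<times> {1..<m} = U \<times> {0..<m}" using assms(3) by auto
  moreover have "U \<union> (I - U) = I" using assms(2) by auto
  ultimately show "bij_betw (glue_base s) (U \<times> {0..<m}) I" by simp
  show "glue_fibre c k \<in> L" if k0: "k \<in> U \<times> {0..<m}"
  proof -
    obtain u i where k: "k = (u, i)" "u \<in> U" "i < m" using k0 by auto
    have "c \<in> U \<times> {1..<m} \<rightarrow>\<^sub>E L" using assms(1) by (simp add: labellings_def)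
    then have "c (u, i) \<in> L" if "i \<noteq> 0" using PiE_mem[of c "U \<times> {1..<m}" "\<lambda>_. L" "(u, i)"] k that by auto
    then show ?thesis using id_L k(1) by (simp add: glue_fibre_def)
  qed
qed

context
  fixes U I :: "'i set" and m :: nat and s :: "'i \<times> nat \<Rightarrow> 'i" and c :: "'i \<times> nat \<Rightarrow> 'a \<Rightarrow> 'a"
  assumes lab: "(s, c) \<in> labellings L (U \<times> {1..<m}) (I - U)" and UI: "U \<subseteq> I" and m: "0 < m"
    and fin: "finite I"
begin

private abbreviation "K \<equiv> U \<times> {0..<m}"
private abbreviation "P \<equiv> bundle_map (glue_base s) (glue_fibre c)"
private abbreviation "R \<equiv> unroll U m (s, c)"

lemmas glue = glue_bij[OF lab UI m]

lemma fin_U: "finite U" using UI fin by (rule finite_subset)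

lemma P_0: "P ((u, 0), a) = (u, a)"
  by (simp add: glue_base_def glue_fibre_def)

lemma unroll_apply: "k \<in> K \<Longrightarrow> R f (P (k, a)) = P (f (k, a))"
  unfolding unroll_def prod.case by (rule conj_map_apply[OF glue])

lemma unroll_aut: "f \<in> aut K \<Longrightarrow> R f \<in> aut I"
  unfolding unroll_def prod.case by (rule conj_map_aut[OF glue])

lemma unroll_comp: "f \<in> aut K \<Longrightarrow> g \<in> aut K \<Longrightarrow> R f \<circ> R g = R (f \<circ> g)"
  unfolding unroll_def prod.case by (rule conj_map_comp[OF glue])

lemma unroll_unique:
  "g \<in> aut I \<Longrightarrow> f \<in> aut K \<Longrightarrow> (\<And>k a. k \<in> K \<Longrightarrow> g (P (k, a)) = P (f (k, a))) \<Longrightarrow> g = R f"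
  unfolding unroll_def prod.case by (rule conj_map_unique[OF glue])

text \<open>Copy 0 is \<open>U\<close> itself by \<open>P_0\<close>. Hence restricting an assembled
  tuple to \<open>U\<close> gives back the maps that were lifted.\<close>

lemma unroll_lift: "u \<in> U \<Longrightarrow> R (lift m f) (u, a) = f (u, a)"
  using unroll_apply[of "(u, 0)" "lift m f" a] m P_0[of u a] P_0[of "fst (f (u, a))" "snd (f (u, a))"] by simp

lemma base_unroll_lift: "u \<in> U \<Longrightarrow> base (R (lift m f)) u = base f u"
  by (simp add: base_def unroll_lift)

lemma restr_unroll_lift: "f \<in> aut U \<Longrightarrow> restr U (R (lift m f)) = f"
  by (auto simp: fun_eq_iff unroll_lift aut_outside)

text \<open>Each step below \<open>m\<close> moves on by one copy, so the powers of the new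
  generator on \<open>U\<close> reveal the labelling.\<close>

lemma unroll_shift_funpow:
  assumes "u \<in> U" "i < m"
  shows "(R (shift U m z) ^^ i) (u, a) = P ((u, i), a)"
  using assms(2)
proof (induction i)
  case 0
  show ?case using P_0 by simp
next
  case (Suc i)
  then have "(R (shift U m z) ^^ Suc i) (u, a) = R (shift U m z) (P ((u, i), a))"
    by (simp del: bundle_map_apply)
  also have "\<dots> = P (shift U m z ((u, i), a))"
    using Suc assms(1) by (intro unroll_apply) auto
  finally show ?case using Suc assms(1) by simp
qed

text \<open>The step after copy \<open>m - 1\<close> returns to copy 0 through \<open>z\<close>, so
  the monodromy can be read off.\<close>

lemma unroll_shift_funpow_m:
  assumes "u \<in> U"
  shows "(R (shift U m z) ^^ m) (u, a) = z (u, a)"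
proof -
  obtain n where n: "m = Suc n" using m gr0_conv_Suc by metis
  have "(R (shift U m z) ^^ m) (u, a) = R (shift U m z) ((R (shift U m z) ^^ n) (u, a))"
    by (simp add: n)
  also have "\<dots> = R (shift U m z) (P ((u, n), a))"
    using unroll_shift_funpow[OF assms, of n z a] n by (simp only: lessI)
  also have "\<dots> = P (shift U m z ((u, n), a))" using assms n by (intro unroll_apply) auto
  also have "\<dots> = P ((fst (z (u, a)), 0), snd (z (u, a)))" using assms n by (simp del: bundle_map_apply)
  also have "\<dots> = z (u, a)" using P_0 by simp
  finally show ?thesis .
qed

text \<open>Commutation, transitivity and trivial bases are established over the \<open>m\<close>
  copies and then carried to \<open>I\<close>, because \<open>unroll\<close> respects
  composition.\<close>

lemma assemble_mem:
  assumes "(z, xs, ys) \<in> ext_tuples j U l"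
  shows "assemble U m ((z, xs, ys), (s, c)) \<in> trans_tuples (Suc j) I l"
proof -
  have z: "z \<in> aut U" "\<And>f. f \<in> set xs \<union> set ys \<Longrightarrow> z \<circ> f = f \<circ> z"
    and W: "length xs = j" "length ys = l" "set xs \<union> set ys \<subseteq> aut U" "commuting_set (set xs \<union> set ys)"
      "transitive_on (base ` set xs) U" "\<And>y. y \<in> set ys \<Longrightarrow> base y = id"
    using assms by (auto simp: ext_tuples_def trans_tuples_def)
  let ?F = "insert (shift U m z) (lift m ` (set xs \<union> set ys))"
  have sz: "shift U m z \<in> aut K" using shift_aut[OF z(1) fin_U] .
  have lf: "lift m f \<in> aut K" if "f \<in> set xs \<union> set ys" for f using lift_aut that W(3) by auto
  have F: "?F \<subseteq> aut K" using sz lf by auto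
  have "commuting_set (lift m ` (set xs \<union> set ys))"
    using W(4) by (rule commuting_set_image) (simp add: lift_comp)
  moreover have "shift U m z \<circ> lift m f = lift m f \<circ> shift U m z" if "f \<in> set xs \<union> set ys" for f
    using shift_lift_commute[OF _ z(1) z(2)[OF that] fin_U] that W(3) by auto
  ultimately have "commuting_set ?F" unfolding commuting_set_def by auto
  then have comm: "commuting_set (R ` ?F)"
    using F unroll_comp by (intro commuting_set_image) auto
  have "transitive_on (base ` insert (shift U m z) (lift m ` set xs)) K"
    using W(3,5) z(1) m by (intro transitive_on_shift) auto
  then have "transitive_on (base ` R ` insert (shift U m z) (lift m ` set xs)) I"
    unfolding unroll_def prod.case using F by (intro transitive_on_conj_map[OF glue]) auto
  then have tr: "transitive_on (base ` insert (R (shift U m z)) ((\<lambda>f. R (lift m f)) ` set xs)) I"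
    by (simp only: image_insert image_image)
  have y: "base (R (lift m y)) = id" if "y \<in> set ys" for y
    unfolding unroll_def prod.case
    using base_conj_map_eq_id[OF glue] lf base_lift_eq_id[OF W(6)[OF that]] that by simp
  show ?thesis
    unfolding assemble_def prod.case trans_tuples_def mem_Collect_eq
  proof (intro conjI)
    let ?xs = "R (shift U m z) # map (\<lambda>f. R (lift m f)) xs" and ?ys = "map (\<lambda>f. R (lift m f)) ys"
    have eq: "set ?xs \<union> set ?ys = R ` ?F" by auto
    show "commuting_set (set ?xs \<union> set ?ys)" unfolding eq by (rule comm)
    show "set ?xs \<union> set ?ys \<subseteq> aut I" unfolding eq using F unroll_aut by auto
    show "transitive_on (base ` set ?xs) I" using tr by simp
  qed (use W y in auto)
qed

end

text \<open>All data can be read off the result: \<open>U\<close> is the orbit of \<open>i0\<close>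
  under the old generators, \<open>m\<close> follows from cardinalities, restriction to
  \<open>U\<close> gives \<open>xs\<close> and \<open>ys\<close>, and the powers of the new
  generator on \<open>U\<close> give the labelling and, at exponent \<open>m\<close>,
  \<open>z\<close>.\<close>

lemma assemble_inj:
  assumes fin: "finite I" and i0: "i0 \<in> U" "i0 \<in> U'" and UI: "U \<subseteq> I" "U' \<subseteq> I"
    and m: "m = card I div card U" "m' = card I div card U'" "0 < m" "0 < m'"
    and p: "p \<in> labellings L (U \<times> {1..<m}) (I - U)" and p': "p' \<in> labellings L (U' \<times> {1..<m'}) (I - U')"
    and t: "t \<in> ext_tuples j U l" and t': "t' \<in> ext_tuples j U' l"
    and eq: "assemble U m (t, p) = assemble U' m' (t', p')"
  shows "U = U' \<and> t = t' \<and> p = p'"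
proof -
  obtain z xs ys where tt: "t = (z, xs, ys)" by (cases t)
  obtain z' xs' ys' where tt': "t' = (z', xs', ys')" by (cases t')
  obtain s c where pp: "p = (s, c)" by fastforce
  obtain s' c' where pp': "p' = (s', c')" by fastforce
  note lab = p[unfolded pp] p'[unfolded pp']
  have W: "z \<in> aut U" "set xs \<union> set ys \<subseteq> aut U" "transitive_on (base ` set xs) U"
    using t by (auto simp: tt ext_tuples_def trans_tuples_def)
  have W': "z' \<in> aut U'" "set xs' \<union> set ys' \<subseteq> aut U'" "transitive_on (base ` set xs') U'"
    using t' by (auto simp: tt' ext_tuples_def trans_tuples_def)
  let ?R = "unroll U m (s, c)" and ?R' = "unroll U' m' (s', c')"
  have e1: "?R (shift U m z) = ?R' (shift U' m' z')"
    and e2: "map (\<lambda>f. ?R (lift m f)) xs = map (\<lambda>f. ?R' (lift m' f)) xs'"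
    and e3: "map (\<lambda>f. ?R (lift m f)) ys = map (\<lambda>f. ?R' (lift m' f)) ys'"
    using eq by (auto simp: assemble_def tt tt' pp pp')
  \<comment> \<open>The new first generator is left out: only under the old generators are
    \<open>U\<close> and \<open>U'\<close> orbits.\<close>
  let ?B = "base ` set (map (\<lambda>f. ?R (lift m f)) xs)"
  have b: "base (?R (lift m f)) u = base f u" if "u \<in> U" for f u
    by (rule base_unroll_lift[OF lab(1) UI(1) m(3) fin that])
  have b': "base (?R' (lift m' f)) u = base f u" if "u \<in> U'" for f u
    by (rule base_unroll_lift[OF lab(2) UI(2) m(4) fin that])
  have "U = U'"
  proof (rule transitive_on_unique[of ?B])
    show "transitive_on ?B U" by (rule transitive_on_cong[OF W(3)]) (use b in auto)
    show "g ` U \<subseteq> U" if g: "g \<in> ?B" for g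
    proof -
      obtain f where f: "f \<in> set xs" "g = base (?R (lift m f))" using g by auto
      have "f \<in> aut U" using f(1) W(2) by auto
      then show ?thesis using f(2) b base_in by auto
    qed
    show "transitive_on ?B U'" unfolding e2 by (rule transitive_on_cong[OF W'(3)]) (use b' in auto)
    show "g ` U' \<subseteq> U'" if g: "g \<in> ?B" for g
    proof -
      obtain f where f: "f \<in> set xs'" "g = base (?R' (lift m' f))" using g unfolding e2 by auto
      have "f \<in> aut U'" using f(1) W'(2) by auto
      then show ?thesis using f(2) b' base_in by auto
    qed
    show "U \<inter> U' \<noteq> {}" using i0 by auto
  qed
  then have mm: "m = m'" using m by simp
  note lab' = lab(2)[folded \<open>U = U'\<close> mm]
  have r: "map (restr U) (map (\<lambda>f. ?R (lift m f)) ws) = ws" if "set ws \<subseteq> aut U" for ws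
    using that restr_unroll_lift[OF lab(1) UI(1) m(3) fin] by (induction ws) auto
  have r': "map (restr U) (map (\<lambda>f. ?R' (lift m' f)) ws) = ws" if "set ws \<subseteq> aut U" for ws
    using that restr_unroll_lift[OF lab(2) UI(2) m(4) fin] \<open>U = U'\<close> by (induction ws) auto
  have sets: "set xs \<subseteq> aut U" "set ys \<subseteq> aut U" "set xs' \<subseteq> aut U" "set ys' \<subseteq> aut U"
    using W(2) W'(2) \<open>U = U'\<close> by auto
  have "xs = xs'" by (rule trans[OF r[OF sets(1), unfolded e2, symmetric] r'[OF sets(3)]])
  moreover have "ys = ys'" by (rule trans[OF r[OF sets(2), unfolded e3, symmetric] r'[OF sets(4)]])
  moreover have "z = z'"
  proof (rule aut_eqI[OF W(1)])
    show "z' \<in> aut U" using W'(1) \<open>U = U'\<close> by simp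
    fix u a assume u: "u \<in> U"
    show "z (u, a) = z' (u, a)"
      using unroll_shift_funpow_m[OF lab(1) UI(1) m(3) fin u, of z a]
        unroll_shift_funpow_m[OF lab' UI(1) m(3) fin u, of z' a] e1 \<open>U = U'\<close> mm by simp
  qed
  moreover have pt: "s (u, i) = s' (u, i) \<and> c (u, i) = c' (u, i)" if ui: "(u, i) \<in> U \<times> {1..<m}" for u i
  proof -
    have u: "u \<in> U" "i < m" "i \<noteq> 0" using ui by auto
    have "bundle_map (glue_base s) (glue_fibre c) ((u, i), a) = bundle_map (glue_base s') (glue_fibre c') ((u, i), a)" for a
      using unroll_shift_funpow[OF lab(1) UI(1) m(3) fin u(1,2), of z a]
        unroll_shift_funpow[OF lab' UI(1) m(3) fin u(1,2), of z' a] e1 \<open>U = U'\<close> mm by (simp del: bundle_map_apply)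
    then show ?thesis using u(3) by (auto simp: glue_base_def glue_fibre_def fun_eq_iff)
  qed
  have "s = s'"
  proof (rule PiE_ext)
    show "s \<in> (U \<times> {1..<m}) \<rightarrow>\<^sub>E (I - U)" "s' \<in> (U \<times> {1..<m}) \<rightarrow>\<^sub>E (I - U)"
      using lab(1) lab' unfolding labellings_def by blast+
  qed (use pt in auto)
  moreover have "c = c'"
  proof (rule PiE_ext)
    show "c \<in> (U \<times> {1..<m}) \<rightarrow>\<^sub>E L" "c' \<in> (U \<times> {1..<m}) \<rightarrow>\<^sub>E L"
      using lab(1) lab' unfolding labellings_def by blast+
  qed (use pt in auto)
  ultimately show ?thesis using \<open>U = U'\<close> by (simp add: tt tt' pp pp')
qed

text \<open>Apply \<open>cyclic_orbit_decomposition\<close> to the first generator \<open>x\<close>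
  and the orbit \<open>U\<close> of \<open>i0\<close> under the others. The powers of
  \<open>x\<close> identify \<open>U\<close> with its translates, and the monodromy is
  \<open>x ^^ m\<close> on \<open>U\<close>.\<close>

lemma assemble_surj:
  fixes I :: "'i set"
  assumes fin: "finite I" and i0: "i0 \<in> I" and X: "X \<in> trans_tuples (Suc j) I l"
  shows "\<exists>U m t p. i0 \<in> U \<and> U \<subseteq> I \<and> 0 < m \<and> card I = card U * m \<and>
     t \<in> ext_tuples j U l \<and> p \<in> labellings L (U \<times> {1..<m}) (I - U) \<and> X = assemble U m (t, p)"
proof -
  obtain xs0 ys where X0: "X = (xs0, ys)" by fastforce
  then obtain x xs where "xs0 = x # xs" using X by (cases xs0) (auto simp: trans_tuples_def)
  then have XX: "X = (x # xs, ys)" using X0 by simp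
  let ?F = "set xs \<union> set ys"
  have X': "length (x # xs) = Suc j \<and> length ys = l \<and> set (x # xs) \<union> set ys \<subseteq> aut I \<and>
     commuting_set (set (x # xs) \<union> set ys) \<and> transitive_on (base ` set (x # xs)) I \<and> (\<forall>y\<in>set ys. base y = id)"
    using X unfolding XX trans_tuples_def mem_Collect_eq prod.case .
  then have len: "length xs = j" "length ys = l" and x: "x \<in> aut I" and F: "?F \<subseteq> aut I"
    and tr: "transitive_on (insert (base x) (base ` set xs)) I" and y: "\<And>y. y \<in> set ys \<Longrightarrow> base y = id"
    by simp_all
  have c0: "commuting_set (set (x # xs) \<union> set ys)" using X' by simp
  have xF: "x \<circ> f = f \<circ> x" if "f \<in> ?F" for f
    using commuting_setD[OF c0] that by simp
  have comm: "commuting_set ?F" using c0 unfolding commuting_set_def by simp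
  have "\<exists>U m. i0 \<in> U \<and> U \<subseteq> I \<and> 0 < m \<and> (\<forall>f\<in>base ` set xs. f ` U \<subseteq> U) \<and> transitive_on (base ` set xs) U \<and>
     bij_betw (\<lambda>(u, i). (base x ^^ i) u) (U \<times> {0..<m}) I \<and> (base x ^^ m) ` U = U"
  proof (rule cyclic_orbit_decomposition[OF fin _ _ _ i0 tr])
    show "f permutes I" if "f \<in> base ` set xs" for f using that F base_permutes by auto
    show "base x permutes I" using x by (rule base_permutes)
    show "base x \<circ> f = f \<circ> base x" if "f \<in> base ` set xs" for f
      using that F base_commute[OF x] xF by auto
  qed
  then obtain U m where U: "i0 \<in> U" "U \<subseteq> I" and m: "0 < m" and st: "\<forall>f\<in>base ` set xs. f ` U \<subseteq> U"
    and trU: "transitive_on (base ` set xs) U"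
    and bij: "bij_betw (\<lambda>(u, i). (base x ^^ i) u) (U \<times> {0..<m}) I" and xm: "(base x ^^ m) ` U = U" by metis
  have finU: "finite U" using U(2) fin by (rule finite_subset)
  \<comment> \<open>The labelling of copy i is given by base and fibre of \<open>x ^^ i\<close>, so
    the glued isomorphism is \<open>x ^^ i\<close> on copy i.\<close>
  let ?s = "restrict (\<lambda>(u, i). (base x ^^ i) u) (U \<times> {1..<m})"
  let ?c = "restrict (\<lambda>(u, i). fibre (x ^^ i) u) (U \<times> {1..<m})"
  let ?z = "restr U (x ^^ m)"
  have xi: "x ^^ i \<in> aut I" for i using x by (rule funpow_aut)
  have stF: "base f ` U \<subseteq> U" if "f \<in> ?F" for f
    using that st y by auto
  have stz: "base (x ^^ m) ` U \<subseteq> U" using xm base_funpow[OF x] by simp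
  have rF: "restr U f \<in> aut U" if "f \<in> ?F" for f
    using restr_aut[OF fin _ U(2) stF[OF that]] that F by auto
  have rz: "?z \<in> aut U" using restr_aut[OF fin xi U(2) stz] .
  have lab: "(?s, ?c) \<in> labellings L (U \<times> {1..<m}) (I - U)"
  proof -
    have "bij_betw (\<lambda>(u, i). (base x ^^ i) u) (U \<times> {0}) U"
      by (rule bij_betwI[where g = "\<lambda>u. (u, 0)"]) auto
    then have "bij_betw (\<lambda>(u, i). (base x ^^ i) u) (U \<times> {0..<m} - U \<times> {0}) (I - U)"
      using bij U(2) m by (intro bij_betw_DiffI) auto
    moreover have "U \<times> {0..<m} - U \<times> {0} = U \<times> {1..<m}" by auto
    ultimately have b: "bij_betw (\<lambda>(u, i). (base x ^^ i) u) (U \<times> {1..<m}) (I - U)" by simp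
    then have "bij_betw ?s (U \<times> {1..<m}) (I - U)" by (subst bij_betw_cong) auto
    moreover have "?s \<in> (U \<times> {1..<m}) \<rightarrow>\<^sub>E (I - U)"
      using bij_betw_apply[OF b] by (intro restrict_PiE_iff[THEN iffD2] ballI)
    moreover have "?c \<in> (U \<times> {1..<m}) \<rightarrow>\<^sub>E L"
      using fibre_L[OF xi] U(2) by (intro restrict_PiE_iff[THEN iffD2]) auto
    ultimately show ?thesis unfolding labellings_def by blast
  qed
  let ?P = "bundle_map (glue_base ?s) (glue_fibre ?c)"
  have P: "?P ((u, i), a) = (x ^^ i) (u, a)" if "u \<in> U" "i < m" for u i a
    using that aut_apply[OF xi, of i u a] by (auto simp: glue_base_def glue_fibre_def base_funpow[OF x])
  \<comment> \<open>In these coordinates \<open>x\<close> raises the exponent by one; at exponent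
    \<open>m\<close> it is back in \<open>U\<close> and acts as \<open>?z\<close>.\<close>
  have sh: "x = unroll U m (?s, ?c) (shift U m ?z)"
  proof (rule unroll_unique[OF lab U(2) m fin x shift_aut[OF rz finU]])
    fix k a assume "k \<in> U \<times> {0..<m}"
    then obtain u i where k: "k = (u, i)" "u \<in> U" "i < m" by auto
    have 1: "x (?P (k, a)) = (x ^^ Suc i) (u, a)" using P[OF k(2,3)] k(1) by (simp del: bundle_map_apply)
    show "x (?P (k, a)) = ?P (shift U m ?z (k, a))"
    proof (cases "Suc i < m")
      case True
      then show ?thesis using 1 P[OF k(2) True] k by (simp del: bundle_map_apply)
    next
      case False
      then have im: "Suc i = m" using k(3) by simp
      have zu: "?z (u, a) = (x ^^ m) (u, a)" using k(2) by simp
      have "fst ((x ^^ m) (u, a)) \<in> U" using stz k(2) by (auto simp: aut_apply[OF xi])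
      then have "?P ((fst ((x ^^ m) (u, a)), 0), snd ((x ^^ m) (u, a))) = (x ^^ m) (u, a)"
        using P[of "fst ((x ^^ m) (u, a))" 0 "snd ((x ^^ m) (u, a))"] m by simp
      then show ?thesis unfolding 1 im using k False zu by (simp del: bundle_map_apply restr_apply)
    qed
  qed
  \<comment> \<open>As \<open>f\<close> commutes with the powers of \<open>x\<close>, it acts on
    each translate as on \<open>U\<close>.\<close>
  have li: "f = unroll U m (?s, ?c) (lift m (restr U f))" if f: "f \<in> ?F" for f
  proof (rule unroll_unique[OF lab U(2) m fin _ lift_aut[OF rF[OF f]]])
    show fI: "f \<in> aut I" using f F by auto
    fix k a assume "k \<in> U \<times> {0..<m}"
    then obtain u i where k: "k = (u, i)" "u \<in> U" "i < m" by auto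
    have "fst (f (u, a)) \<in> U" using stF[OF f] k(2) by (auto simp: aut_apply[OF fI])
    then have "?P ((fst (f (u, a)), i), snd (f (u, a))) = (x ^^ i) (f (u, a))"
      using P[of "fst (f (u, a))" i "snd (f (u, a))"] k(3) by simp
    also have "\<dots> = f ((x ^^ i) (u, a))"
      using fun_cong[OF funpow_commute[OF xF[OF f], of i], of "(u, a)"] by simp
    finally show "f (?P (k, a)) = ?P (lift m (restr U f) (k, a))"
      using P[OF k(2,3)] k by (simp del: bundle_map_apply)
  qed
  have t: "(?z, map (restr U) xs, map (restr U) ys) \<in> ext_tuples j U l"
  proof -
    have c: "restr U f \<circ> restr U g = restr U (f \<circ> g)" if "g \<in> ?F" for f g
      using restr_comp[OF _ stF[OF that]] that F by auto
    have "commuting_set (restr U ` ?F)" using comm c by (rule commuting_set_image)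
    then have 1: "commuting_set (set (map (restr U) xs) \<union> set (map (restr U) ys))" by (simp add: image_Un)
    have 2: "transitive_on (base ` set (map (restr U) xs)) U"
      by (rule transitive_on_cong[OF trU]) (auto simp: base_restr)
    have 3: "base (restr U g) = id" if "g \<in> set ys" for g
      using y[OF that] by (auto simp: fun_eq_iff base_restr)
    have 4: "?z \<circ> restr U f = restr U f \<circ> ?z" if f: "f \<in> ?F" for f
      using c[OF f] restr_comp[OF xi stz] funpow_commute[OF xF[OF f]] by metis
    show ?thesis unfolding ext_tuples_def trans_tuples_def mem_Collect_eq prod.case
      using rz len rF 1 2 3 4 by (auto simp: image_subset_iff)
  qed
  have "card I = card U * m" using bij_betw_same_card[OF bij] by (simp add: card_cartesian_product)
  moreover have "X = assemble U m ((?z, map (restr U) xs, map (restr U) ys), (?s, ?c))"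
    unfolding XX assemble_def prod.case using sh li by (auto simp: o_def intro!: map_idI[symmetric])
  ultimately show ?thesis using U m t lab by (intro exI conjI)
qed

end

section \<open>Counting transitive tuples\<close>

text \<open>The operation is a parameter, so that group multiplication and composition of functions
  can be compared.\<close>

definition comm_lists :: "('g \<Rightarrow> 'g \<Rightarrow> 'g) \<Rightarrow> nat \<Rightarrow> 'g set \<Rightarrow> 'g list set" where
  "comm_lists opr l S = {xs. length xs = l \<and> set xs \<subseteq> S \<and> (\<forall>a\<in>set xs. \<forall>b\<in>set xs. opr a b = opr b a)}"

text \<open>Closure of \<open>S\<close> keeps both products within the domain of injectivity, so
  \<open>h\<close> reflects commutation as well as preserving it.\<close>

lemma card_comm_lists_iso:
  assumes h: "bij_betw h S T" and hom: "\<And>a b. a \<in> S \<Longrightarrow> b \<in> S \<Longrightarrow> h (opr a b) = opr' (h a) (h b)"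
    and closed: "\<And>a b. a \<in> S \<Longrightarrow> b \<in> S \<Longrightarrow> opr a b \<in> S"
  shows "card (comm_lists opr l S) = card (comm_lists opr' l T)"
proof -
  have inj: "inj_on h S" and img: "h ` S = T" using h by (auto simp: bij_betw_def)
  have iff: "opr' (h a) (h b) = opr' (h b) (h a) \<longleftrightarrow> opr a b = opr b a" if "a \<in> S" "b \<in> S" for a b
    using hom[of a b] hom[of b a] that closed inj_onD[OF inj, of "opr a b" "opr b a"] by auto
  have "bij_betw (map h) (comm_lists opr l S) (comm_lists opr' l T)"
  proof (rule bij_betw_imageI)
    show "inj_on (map h) (comm_lists opr l S)"
    proof (rule inj_onI)
      fix xs ys assume xy: "xs \<in> comm_lists opr l S" "ys \<in> comm_lists opr l S" "map h xs = map h ys"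
      then have "inj_on h (set xs \<union> set ys)"
        by (intro inj_on_subset[OF inj]) (auto simp: comm_lists_def)
      then show "xs = ys" using xy(3) by (simp add: inj_on_map_eq_map)
    qed
    show "map h ` comm_lists opr l S = comm_lists opr' l T"
    proof (intro equalityI subsetI)
      fix ys assume "ys \<in> map h ` comm_lists opr l S"
      then obtain xs where xs: "ys = map h xs" "length xs = l" "set xs \<subseteq> S"
        "\<forall>a\<in>set xs. \<forall>b\<in>set xs. opr a b = opr b a" by (auto simp: comm_lists_def)
      have "opr' (h a) (h b) = opr' (h b) (h a)" if "a \<in> set xs" "b \<in> set xs" for a b
        using iff[of a b] that xs(3,4) by auto
      then show "ys \<in> comm_lists opr' l T" using xs img by (auto simp: comm_lists_def)
    next
      fix ys assume "ys \<in> comm_lists opr' l T"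
      then have ys: "length ys = l" "set ys \<subseteq> h ` S" "\<forall>a\<in>set ys. \<forall>b\<in>set ys. opr' a b = opr' b a"
        using img by (auto simp: comm_lists_def)
      have "ys \<in> map h ` lists S" unfolding lists_image[symmetric] using ys(2) by auto
      then obtain xs where xs: "ys = map h xs" "set xs \<subseteq> S" by (auto simp: lists_eq_set)
      have "opr a b = opr b a" if "a \<in> set xs" "b \<in> set xs" for a b
        using iff[of a b] that xs ys(3) by auto
      then have "xs \<in> comm_lists opr l S" using xs ys(1) by (auto simp: comm_lists_def)
      then show "ys \<in> map h ` comm_lists opr l S" using xs(1) by (rule rev_image_eqI)
    qed
  qed
  then show ?thesis by (rule bij_betw_same_card)
qed

definition comp_lists :: "nat \<Rightarrow> ('e \<Rightarrow> 'e) set \<Rightarrow> ('e \<Rightarrow> 'e) list set" where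
  "comp_lists l S = {xs. length xs = l \<and> set xs \<subseteq> S \<and> commuting_set (set xs)}"

lemma comp_lists_eq: "comp_lists l S = comm_lists (\<circ>) l S"
  by (simp add: comp_lists_def comm_lists_def commuting_set_def)

text \<open>Deleting \<open>i0\<close> turns the subsets of size d containing it into the subsets of
  size d - 1 of the remaining points.\<close>

lemma sum_subsets_containing:
  fixes g :: "nat \<Rightarrow> nat"
  assumes fin: "finite I" and i0: "i0 \<in> I"
  shows "(\<Sum>U | U \<subseteq> I \<and> i0 \<in> U. g (card U)) = (\<Sum>d=1..card I. (card I - 1 choose (d - 1)) * g d)"
proof -
  let ?S = "{U. U \<subseteq> I \<and> i0 \<in> U}"
  have finS: "finite ?S" using fin by auto
  have cnt: "card {U \<in> ?S. card U = d} = (card I - 1 choose (d - 1))" if d: "d \<in> {1..card I}" for d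
  proof -
    have "bij_betw (insert i0) {B. B \<subseteq> I - {i0} \<and> card B = d - 1} {U \<in> ?S. card U = d}"
    proof (rule bij_betwI[where g = "\<lambda>U. U - {i0}"])
      show "insert i0 \<in> {B. B \<subseteq> I - {i0} \<and> card B = d - 1} \<rightarrow> {U \<in> ?S. card U = d}"
      proof
        fix B assume B: "B \<in> {B. B \<subseteq> I - {i0} \<and> card B = d - 1}"
        then have "finite B" "i0 \<notin> B" using fin finite_subset[of B I] by auto
        then show "insert i0 B \<in> {U \<in> ?S. card U = d}" using B i0 d by auto
      qed
      show "(\<lambda>U. U - {i0}) \<in> {U \<in> ?S. card U = d} \<rightarrow> {B. B \<subseteq> I - {i0} \<and> card B = d - 1}"
        using fin by auto
    qed auto
    then have "card {U \<in> ?S. card U = d} = card {B. B \<subseteq> I - {i0} \<and> card B = d - 1}"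
      by (rule bij_betw_same_card[symmetric])
    also have "\<dots> = (card I - 1 choose (d - 1))" using fin i0 by (simp add: n_subsets)
    finally show ?thesis .
  qed
  have "card ` ?S \<subseteq> {1..card I}"
  proof clarify
    fix U assume U: "U \<subseteq> I" "i0 \<in> U"
    then have "0 < card U" using finite_subset[OF U(1) fin] by (auto simp: card_gt_0_iff)
    then show "card U \<in> {1..card I}" using card_mono[OF fin U(1)] by auto
  qed
  then have "(\<Sum>U\<in>?S. g (card U)) = (\<Sum>d=1..card I. \<Sum>U\<in>{U \<in> ?S. card U = d}. g (card U))"
    using finS by (intro sum.group[symmetric]) auto
  also have "\<dots> = (\<Sum>d=1..card I. (card I - 1 choose (d - 1)) * g d)"
  proof (rule sum.cong)
    fix d assume d: "d \<in> {1..card I}"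
    have "(\<Sum>U\<in>{U \<in> ?S. card U = d}. g (card U)) = (\<Sum>U\<in>{U \<in> ?S. card U = d}. g d)"
      by (rule sum.cong) auto
    also have "\<dots> = card {U \<in> ?S. card U = d} * g d" by simp
    finally show "(\<Sum>U\<in>{U \<in> ?S. card U = d}. g (card U)) = (card I - 1 choose (d - 1)) * g d"
      by (simp only: cnt[OF d])
  qed simp
  finally show ?thesis .
qed

lemma choose_fact_shift:
  assumes "1 \<le> d" "d \<le> r"
  shows "(r - 1 choose (d - 1)) * (fact (d - 1) * fact (r - d)) = (fact (r - 1) :: nat)"
proof -
  have "r - 1 - (d - 1) = r - d" "d - 1 \<le> r - 1" using assms by auto
  then show ?thesis using binomial_fact_lemma[of "d - 1" "r - 1"] by (simp add: mult_ac)
qed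

context bij_group begin

lemma trans_tuples_empty: "trans_tuples j {} l = {}"
  by (auto simp: trans_tuples_def transitive_on_def)

text \<open>Sum over the orbit \<open>U\<close> of \<open>i0\<close> under all generators but the
  first. By \<open>card_ext_tuples\<close> the tuples on \<open>U\<close> with a monodromy give the
  factor \<open>card U\<close> and one more base-trivial element; the labellings of the other copies
  give the factorial and the power of \<open>card L\<close>. The size of \<open>U\<close> divides
  that of \<open>I\<close>, as translates of \<open>U\<close> partition \<open>I\<close>.\<close>

lemma card_trans_tuples_Suc:
  fixes I :: "'i set"
  assumes fin: "finite I" and i0: "i0 \<in> I"
  shows "card (trans_tuples (Suc j) I l) = (\<Sum>U | U \<subseteq> I \<and> i0 \<in> U \<and> card U dvd card I.
     card U * card (trans_tuples j U (Suc l)) * (fact (card I - card U) * card L ^ (card I - card U)))"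
proof -
  let ?S = "{U. U \<subseteq> I \<and> i0 \<in> U \<and> card U dvd card I}"
  let ?m = "\<lambda>U. card I div card U"
  let ?lab = "\<lambda>U. labellings L (U \<times> {1..<?m U}) (I - U)"
  let ?D = "SIGMA U:?S. ext_tuples j U l \<times> ?lab U"
  have U: "finite U" "0 < card U" "0 < ?m U" "card I = card U * ?m U" if "U \<in> ?S" for U
  proof -
    show f: "finite U" using that fin finite_subset by auto
    show c: "0 < card U" using that f card_gt_0_iff by auto
    show "card I = card U * ?m U" using that by simp
    moreover have "0 < card I" using fin i0 card_gt_0_iff by auto
    ultimately show "0 < ?m U" by (metis gr0I mult_0_right)
  qed
  have "bij_betw (\<lambda>(U, d). assemble U (?m U) d) ?D (trans_tuples (Suc j) I l)"
  proof (rule bij_betw_imageI)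
    show "inj_on (\<lambda>(U, d). assemble U (?m U) d) ?D"
    proof (rule inj_onI)
      fix p q assume pq: "p \<in> ?D" "q \<in> ?D" "(\<lambda>(U, d). assemble U (?m U) d) p = (\<lambda>(U, d). assemble U (?m U) d) q"
      obtain V t b where p: "p = (V, t, b)" by (cases p)
      obtain V' t' b' where q: "q = (V', t', b')" by (cases q)
      have V: "V \<in> ?S" "V' \<in> ?S" "t \<in> ext_tuples j V l" "t' \<in> ext_tuples j V' l" "b \<in> ?lab V" "b' \<in> ?lab V'"
        "assemble V (?m V) (t, b) = assemble V' (?m V') (t', b')"
        using pq p q by auto
      have "V = V' \<and> t = t' \<and> b = b'"
        using V(1,2) by (intro assemble_inj[OF fin _ _ _ _ refl refl U(3)[OF V(1)] U(3)[OF V(2)] V(5,6,3,4,7), of i0]) auto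
      then show "p = q" using p q by simp
    qed
    show "(\<lambda>(U, d). assemble U (?m U) d) ` ?D = trans_tuples (Suc j) I l"
    proof (intro equalityI subsetI)
      fix X assume "X \<in> (\<lambda>(U, d). assemble U (?m U) d) ` ?D"
      then obtain V z xs ys s c where V: "V \<in> ?S" "(z, xs, ys) \<in> ext_tuples j V l" "(s, c) \<in> ?lab V"
        "X = assemble V (?m V) ((z, xs, ys), (s, c))" by auto
      show "X \<in> trans_tuples (Suc j) I l"
        unfolding V(4) using V(1) by (intro assemble_mem[OF V(3) _ U(3)[OF V(1)] fin V(2)]) auto
    next
      fix X assume "X \<in> trans_tuples (Suc j) I l"
      then obtain V m t p where V: "i0 \<in> V" "V \<subseteq> I" "0 < m" "card I = card V * m"
        "t \<in> ext_tuples j V l" "p \<in> labellings L (V \<times> {1..<m}) (I - V)" "X = assemble V m (t, p)"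
        using assemble_surj[OF fin i0] by metis
      have VS: "V \<in> ?S" using V by simp
      have "m = ?m V" using V(4) U(2)[OF VS] by simp
      then have "(V, t, p) \<in> ?D" "X = (\<lambda>(U, d). assemble U (?m U) d) (V, t, p)" using V VS by auto
      then show "X \<in> (\<lambda>(U, d). assemble U (?m U) d) ` ?D" by (rule rev_image_eqI)
    qed
  qed
  then have "card (trans_tuples (Suc j) I l) = card ?D" by (rule bij_betw_same_card[symmetric])
  also have "\<dots> = (\<Sum>U\<in>?S. card (ext_tuples j U l \<times> ?lab U))"
  proof (rule card_SigmaI)
    show "finite ?S" using fin by auto
    show "\<forall>U\<in>?S. finite (ext_tuples j U l \<times> ?lab U)"
    proof
      fix V assume V: "V \<in> ?S"
      have "ext_tuples j V l \<subseteq> aut V \<times> trans_tuples j V l" by (auto simp: ext_tuples_def)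
      then have "finite (ext_tuples j V l)"
        by (rule finite_subset) (simp add: finite_aut finite_trans_tuples U(1)[OF V])
      moreover have "finite (?lab V)"
      proof -
        have "finite (V \<times> {1..<?m V} \<rightarrow>\<^sub>E (I - V))" "finite (V \<times> {1..<?m V} \<rightarrow>\<^sub>E L)"
          using U(1)[OF V] fin finite_L by (auto intro!: finite_PiE)
        then show ?thesis unfolding labellings_def by simp
      qed
      ultimately show "finite (ext_tuples j V l \<times> ?lab V)" by simp
    qed
  qed
  also have "\<dots> = (\<Sum>U\<in>?S. card U * card (trans_tuples j U (Suc l)) * (fact (card I - card U) * card L ^ (card I - card U)))"
  proof (rule sum.cong)
    fix V assume V: "V \<in> ?S"
    have cI: "card (I - V) = card I - card V" using V U(1)[OF V] by (simp add: card_Diff_subset)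
    \<comment> \<open>The copies other than copy 0 have together as many points as
      \<open>I - V\<close>, as \<open>card_labellings\<close> demands.\<close>
    have "card (V \<times> {1..<?m V}) = card V * (?m V - 1)" by (simp add: card_cartesian_product)
    also have "\<dots> = card V * ?m V - card V" by (simp add: diff_mult_distrib2)
    also have "\<dots> = card (I - V)" using U(4)[OF V] cI by simp
    finally have "card (?lab V) = fact (card (I - V)) * card L ^ card (I - V)"
      using U(1)[OF V] fin by (intro card_labellings) auto
    then show "card (ext_tuples j V l \<times> ?lab V) =
        card V * card (trans_tuples j V (Suc l)) * (fact (card I - card V) * card L ^ (card I - card V))"
      using card_ext_tuples[OF U(1)[OF V]] cI by (simp only: card_cartesian_product)
  qed simp
  finally show ?thesis .
qed

text \<open>Over one point an automorphism is just its fibre map, and one point needs no generators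
  for transitivity.\<close>

lemma card_trans_tuples_0:
  fixes i :: 'i
  shows "card (trans_tuples 0 {i} l) = card (comp_lists l L)"
proof -
  define h :: "('a \<Rightarrow> 'a) \<Rightarrow> 'i \<times> 'a \<Rightarrow> 'i \<times> 'a" where "h c = bundle_map id (\<lambda>k. if k = i then c else id)" for c
  have base_id: "base y = id" if "y \<in> aut {i}" for y
    using base_permutes[OF that] by (simp add: permutes_sing)
  have "bij_betw h L (aut {i})"
  proof (rule bij_betwI[where g = "\<lambda>y. fibre y i"])
    show "h \<in> L \<rightarrow> aut {i}"
      unfolding h_def aut_def by (auto intro!: exI[of _ id] simp: permutes_id)
    show "(\<lambda>y. fibre y i) \<in> aut {i} \<rightarrow> L" using fibre_L[of _ "{i}" i] by auto
    show "fibre (h c) i = c" for c by (simp add: h_def)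
    show "h (fibre y i) = y" if "y \<in> aut {i}" for y
    proof (rule aut_eqI[OF _ that])
      show "h (fibre y i) \<in> aut {i}"
        unfolding h_def aut_def using fibre_L[OF that]
        by (intro CollectI exI[of _ id] exI[of _ "\<lambda>k. if k = i then fibre y i else id"]) (auto simp: permutes_id)
      show "h (fibre y i) (k, a) = y (k, a)" if "k \<in> {i}" for k a
        using that base_id[OF \<open>y \<in> aut {i}\<close>] by (simp add: h_def aut_apply[OF \<open>y \<in> aut {i}\<close>])
    qed
  qed
  then have "card (comp_lists l L) = card (comp_lists l (aut {i}))"
    unfolding comp_lists_eq by (rule card_comm_lists_iso) (auto simp: h_def fun_eq_iff comp_L)
  moreover have "trans_tuples 0 {i} l = {[]} \<times> comp_lists l (aut {i})"
  proof -
    have "transitive_on {} {i}" by (auto simp: transitive_on_def)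
    then show ?thesis using base_id
      by (auto simp: trans_tuples_def comp_lists_def)
  qed
  ultimately show ?thesis by (simp add: card_cartesian_product)
qed

text \<open>Induction on \<open>j\<close> for all \<open>l\<close>: each step trades a generator for
  a base-trivial element, so \<open>j + l\<close> and with it the last factor stay fixed. The
  binomial coefficient counting the orbits of size d absorbs the factorials, the powers of
  \<open>card L\<close> combine, and the sum of \<open>d * sublattices j d\<close> over the divisors
  d remains.\<close>

theorem card_trans_tuples:
  fixes I :: "'i set"
  assumes "finite I"
  shows "card (trans_tuples j I l) =
    fact (card I - 1) * card L ^ (card I - 1) * sublattices j (card I) * card (comp_lists (j + l) L)"
  using assms
proof (induction j arbitrary: I l)
  case 0
  show ?case
  proof (cases "card I = 1")
    case True
    then obtain i where I: "I = {i}" by (auto simp: card_1_singleton_iff)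
    show ?thesis unfolding I card_trans_tuples_0 by simp
  next
    case False
    \<comment> \<open>Without generators every singleton is stable.\<close>
    have "\<not> transitive_on {} I"
    proof
      assume tr: "transitive_on {} I"
      then obtain i where "i \<in> I" by (auto simp: transitive_on_def)
      then have "{i} = I" by (intro transitive_onD[OF tr]) auto
      then show False using False by auto
    qed
    then have "trans_tuples 0 I l = {}" by (auto simp: trans_tuples_def)
    then show ?thesis using False by simp
  qed
next
  case (Suc j)
  show ?case
  proof (cases "I = {}")
    \<comment> \<open>Both sides are 0: nothing is transitive on the empty set, and
      \<open>sublattices\<close> vanishes at 0.\<close>
    case True
    then show ?thesis by (simp add: trans_tuples_empty del: sublattices.simps)
  next
    case False
    then obtain i0 where i0: "i0 \<in> I" by auto
    define r where "r = card I"
    have r: "0 < r" using Suc.prems False by (auto simp: r_def card_gt_0_iff)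
    define q where "q = card L"
    define C where "C = card (comp_lists (Suc j + l) L)"
    \<comment> \<open>The value 0 for non-divisors moves the divisibility condition into the
      summand, so the sum runs over all subsets containing \<open>i0\<close>.\<close>
    define g where "g d = (if d dvd r then
      d * (fact (d - 1) * q ^ (d - 1) * sublattices j d * C) * (fact (r - d) * q ^ (r - d)) else 0)" for d
    have "card (trans_tuples (Suc j) I l) = (\<Sum>U | U \<subseteq> I \<and> i0 \<in> U \<and> card U dvd r.
       card U * card (trans_tuples j U (Suc l)) * (fact (r - card U) * q ^ (r - card U)))"
      unfolding r_def q_def by (rule card_trans_tuples_Suc[OF Suc.prems i0])
    also have "\<dots> = (\<Sum>U | U \<subseteq> I \<and> i0 \<in> U. g (card U))"
    proof (rule sum.mono_neutral_cong_left)
      show "finite {U. U \<subseteq> I \<and> i0 \<in> U}" using Suc.prems by auto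
      fix U assume U: "U \<in> {U. U \<subseteq> I \<and> i0 \<in> U \<and> card U dvd r}"
      then have "finite U" using Suc.prems finite_subset by auto
      then show "card U * card (trans_tuples j U (Suc l)) * (fact (r - card U) * q ^ (r - card U)) = g (card U)"
        using U Suc.IH[of U "Suc l"] by (simp add: g_def q_def C_def)
    qed (auto simp: g_def)
    also have "\<dots> = (\<Sum>d=1..r. (r - 1 choose (d - 1)) * g d)"
      unfolding r_def by (rule sum_subsets_containing[OF Suc.prems i0])
    also have "\<dots> = (\<Sum>d | d dvd r. (r - 1 choose (d - 1)) * g d)"
      using r by (intro sum.mono_neutral_right) (auto simp: g_def Suc_le_eq dest: dvd_imp_le intro: Nat.gr0I)
    also have "\<dots> = (\<Sum>d | d dvd r. fact (r - 1) * q ^ (r - 1) * C * (d * sublattices j d))"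
    proof (rule sum.cong)
      fix d assume "d \<in> {d. d dvd r}"
      then have d: "d dvd r" "1 \<le> d" "d \<le> r" using r by (auto simp: Suc_le_eq dest: dvd_imp_le intro: Nat.gr0I)
      have "r - 1 = (d - 1) + (r - d)" using d by simp
      then have q: "q ^ (r - 1) = q ^ (d - 1) * q ^ (r - d)" by (simp only: power_add)
      have "(r - 1 choose (d - 1)) * g d =
          ((r - 1 choose (d - 1)) * (fact (d - 1) * fact (r - d))) * (q ^ (d - 1) * q ^ (r - d)) * C * (d * sublattices j d)"
        using d(1) by (simp add: g_def mult_ac)
      then show "(r - 1 choose (d - 1)) * g d = fact (r - 1) * q ^ (r - 1) * C * (d * sublattices j d)"
        unfolding choose_fact_shift[OF d(2,3)] q[symmetric] .
    qed simp
    also have "\<dots> = fact (r - 1) * q ^ (r - 1) * sublattices (Suc j) r * C"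
      by (simp add: sum_distrib_left[symmetric])
    finally show ?thesis by (simp only: r_def q_def C_def add_Suc)
  qed
qed

section \<open>The exponential recurrence\<close>

lemma aut_mono:
  assumes "f \<in> aut U" "U \<subseteq> I"
  shows "f \<in> aut I"
proof -
  obtain s c where f: "f = bundle_map s c" "s permutes U" "\<And>i. i \<in> U \<Longrightarrow> c i \<in> L" "\<And>i. i \<notin> U \<Longrightarrow> c i = id"
    using autE[OF assms(1)] by metis
  have "s permutes I" using f(2) assms(2) by (rule permutes_subset)
  moreover have "c i \<in> L" for i using f(3,4)[of i] id_L by (cases "i \<in> U") auto
  moreover have "c i = id" if "i \<notin> I" for i using f(4)[of i] that assms(2) by auto
  ultimately show ?thesis unfolding aut_def f(1) by auto
qed

text \<open>The map over \<open>I - U\<close> keeps the points outside \<open>U\<close> outside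
  \<open>U\<close>, so the two factors never interfere.\<close>

lemma aut_union_apply:
  assumes "f \<in> aut U" "g \<in> aut (I - U)"
  shows "(f \<circ> g) (i, a) = (if i \<in> U then f (i, a) else g (i, a))"
proof (cases "i \<in> U")
  case True
  then show ?thesis using aut_outside[OF assms(2)] by simp
next
  case False
  have "base g i \<notin> U"
    using base_in[OF assms(2), of i] permutes_not_in[OF base_permutes[OF assms(2)], of i] False
    by (cases "i \<in> I") auto
  then show ?thesis using False aut_apply[OF assms(2), of i a] aut_outside[OF assms(1)] by simp
qed

lemma aut_disjoint_commute:
  assumes "f \<in> aut U" "g \<in> aut (I - U)"
  shows "g \<circ> f = f \<circ> g"
proof
  fix e :: "'b \<times> 'a"
  obtain i a where e: "e = (i, a)" by fastforce
  have "(g \<circ> f) (i, a) = (if i \<in> U then f (i, a) else g (i, a))"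
  proof (cases "i \<in> U")
    case True
    have "base f i \<notin> I - U" using base_in[OF assms(1) True] by auto
    then show ?thesis using True aut_apply[OF assms(1), of i a] aut_outside[OF assms(2)] by simp
  next
    case False
    then show ?thesis using aut_outside[OF assms(1)] by simp
  qed
  then show "(g \<circ> f) e = (f \<circ> g) e" using aut_union_apply[OF assms] e by metis
qed

lemma restr_union:
  assumes "f \<in> aut U" "g \<in> aut (I - U)"
  shows "restr U (f \<circ> g) = f" "restr (I - U) (f \<circ> g) = g"
proof -
  show "restr U (f \<circ> g) = f"
  proof
    fix e :: "'b \<times> 'a"
    obtain i a where e: "e = (i, a)" by fastforce
    show "restr U (f \<circ> g) e = f e"
      unfolding e restr_apply aut_union_apply[OF assms] using aut_outside[OF assms(1)] by auto
  qed
  show "restr (I - U) (f \<circ> g) = g"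
  proof
    fix e :: "'b \<times> 'a"
    obtain i a where e: "e = (i, a)" by fastforce
    show "restr (I - U) (f \<circ> g) e = g e"
      unfolding e restr_apply aut_union_apply[OF assms] using aut_outside[OF assms(2)] by auto
  qed
qed

lemma base_union: "f \<in> aut U \<Longrightarrow> g \<in> aut (I - U) \<Longrightarrow> i \<in> U \<Longrightarrow> base (f \<circ> g) i = base f i"
  unfolding base_def by (simp only: aut_union_apply if_True)

text \<open>The orbit \<open>U\<close> of \<open>i0\<close> and its complement are both stable, so a
  commuting tuple over \<open>I\<close> is the same as a transitive one over \<open>U\<close>
  together with an arbitrary one over \<open>I - U\<close>. This is the exponential formula with a
  marked point.\<close>

lemma card_comp_lists_aut_rec:
  fixes I :: "'i set"
  assumes fin: "finite I" and i0: "i0 \<in> I"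
  shows "card (comp_lists j (aut I)) =
    (\<Sum>U | U \<subseteq> I \<and> i0 \<in> U. card (trans_tuples j U 0) * card (comp_lists j (aut (I - U))))"
proof -
  let ?S = "{U. U \<subseteq> I \<and> i0 \<in> U}"
  let ?A = "\<lambda>J. comp_lists j (aut J)"
  let ?D = "SIGMA U:?S. trans_tuples j U 0 \<times> ?A (I - U)"
  \<comment> \<open>Composes entry by entry; the list of base-trivial elements is empty
    here.\<close>
  let ?h = "\<lambda>(U::'i set, (xs, ys :: ('i \<times> 'a \<Rightarrow> 'i \<times> 'a) list), ws). map2 (\<circ>) xs ws"
  have D: "\<exists>U xs ws. p = (U, (xs, []), ws) \<and> U \<subseteq> I \<and> i0 \<in> U \<and> length xs = j \<and> length ws = j \<and>
      set xs \<subseteq> aut U \<and> set ws \<subseteq> aut (I - U) \<and> commuting_set (set xs) \<and> commuting_set (set ws) \<and>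
      transitive_on (base ` set xs) U" if p: "p \<in> ?D" for p
  proof -
    obtain U xs ys ws where p': "p = (U, (xs, ys), ws)" by (cases p) auto
    then show ?thesis using p by (auto simp: trans_tuples_def comp_lists_def)
  qed
  have nth: "xs ! t \<in> aut U" if "set xs \<subseteq> aut U" "t < length xs" for xs t and U :: "'i set"
    using that nth_mem by (meson subsetD)
  have restr_map: "map (restr U) (map2 (\<circ>) xs ws) = xs" "map (restr (I - U)) (map2 (\<circ>) xs ws) = ws"
    if "length xs = j" "length ws = j" "set xs \<subseteq> aut U" "set ws \<subseteq> aut (I - U)" for U xs ws
    using restr_union[OF nth[OF that(3)] nth[OF that(4)]] that(1,2)
    by (auto intro!: nth_equalityI simp: map_map[symmetric] simp del: o_apply map_map)
  have stable: "transitive_on (base ` set (map2 (\<circ>) xs ws)) U"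
    "\<And>b. b \<in> base ` set (map2 (\<circ>) xs ws) \<Longrightarrow> b ` U \<subseteq> U"
    if h: "length xs = j" "length ws = j" "set xs \<subseteq> aut U" "set ws \<subseteq> aut (I - U)"
      "transitive_on (base ` set xs) U" for U xs ws
  proof -
    show "transitive_on (base ` set (map2 (\<circ>) xs ws)) U"
    proof (rule transitive_on_cong[OF h(5)])
      fix b assume "b \<in> base ` set xs"
      then obtain t where t: "t < j" "b = base (xs ! t)" using h(1) by (auto simp: in_set_conv_nth)
      have "xs ! t \<circ> ws ! t \<in> set (map2 (\<circ>) xs ws)" using t h(1,2) by (auto simp: set_zip)
      moreover have "\<forall>i\<in>U. base (xs ! t \<circ> ws ! t) i = b i"
        using base_union[OF nth[OF h(3)] nth[OF h(4)]] t h(1,2) by simp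
      ultimately show "\<exists>g\<in>base ` set (map2 (\<circ>) xs ws). \<forall>i\<in>U. g i = b i" by blast
    qed
    fix b assume "b \<in> base ` set (map2 (\<circ>) xs ws)"
    then obtain t where t: "t < j" "b = base (xs ! t \<circ> ws ! t)" using h(1,2) by (auto simp: set_zip)
    show "b ` U \<subseteq> U"
      using base_union[OF nth[OF h(3)] nth[OF h(4)], of t t] base_in[OF nth[OF h(3)], of t] t h(1,2) by auto
  qed
  have "bij_betw ?h ?D (?A I)"
  proof (rule bij_betw_imageI)
    show "inj_on ?h ?D"
    proof (rule inj_onI)
      fix p q assume pq: "p \<in> ?D" "q \<in> ?D" "?h p = ?h q"
      obtain U xs ws where p: "p = (U, (xs, []), ws)" "i0 \<in> U" "length xs = j" "length ws = j"
        "set xs \<subseteq> aut U" "set ws \<subseteq> aut (I - U)" "transitive_on (base ` set xs) U"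
        using D[OF pq(1)] by (elim exE conjE)
      obtain U' xs' ws' where q: "q = (U', (xs', []), ws')" "i0 \<in> U'" "length xs' = j" "length ws' = j"
        "set xs' \<subseteq> aut U'" "set ws' \<subseteq> aut (I - U')" "transitive_on (base ` set xs') U'"
        using D[OF pq(2)] by (elim exE conjE)
      have e: "map2 (\<circ>) xs ws = map2 (\<circ>) xs' ws'" using pq(3) p(1) q(1) by simp
      have UU: "U = U'"
      proof (rule transitive_on_unique)
        show "transitive_on (base ` set (map2 (\<circ>) xs ws)) U" by (rule stable(1)[OF p(3-7)])
        show "transitive_on (base ` set (map2 (\<circ>) xs ws)) U'" unfolding e by (rule stable(1)[OF q(3-7)])
        show "U \<inter> U' \<noteq> {}" using p(2) q(2) by auto
        show "b ` U \<subseteq> U" if "b \<in> base ` set (map2 (\<circ>) xs ws)" for b by (rule stable(2)[OF p(3-7) that])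
        show "b ` U' \<subseteq> U'" if "b \<in> base ` set (map2 (\<circ>) xs ws)" for b
          by (rule stable(2)[OF q(3-7) that[unfolded e]])
      qed
      have "xs = xs'"
        by (rule trans[OF restr_map(1)[OF p(3-6), unfolded e, symmetric] restr_map(1)[OF q(3-6), folded UU]])
      moreover have "ws = ws'"
        by (rule trans[OF restr_map(2)[OF p(3-6), unfolded e, symmetric] restr_map(2)[OF q(3-6), folded UU]])
      ultimately show "p = q" using p(1) q(1) UU by simp
    qed
    show "?h ` ?D = ?A I"
    proof (intro equalityI subsetI)
      fix X assume "X \<in> ?h ` ?D"
      then obtain p where p0: "p \<in> ?D" "X = ?h p" by (elim imageE)
      obtain U xs ws where p: "p = (U, (xs, []), ws)" "U \<subseteq> I" "length xs = j" "length ws = j"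
        "set xs \<subseteq> aut U" "set ws \<subseteq> aut (I - U)" "commuting_set (set xs)" "commuting_set (set ws)"
        using D[OF p0(1)] by (elim exE conjE)
      have X: "X = map2 (\<circ>) xs ws" using p0(2) p(1) by simp
      have fI: "xs ! t \<in> aut U" "ws ! t \<in> aut (I - U)" if "t < j" for t
        using nth[OF p(5)] nth[OF p(6)] that p(3,4) by auto
      have el: "\<exists>t<j. x = xs ! t \<circ> ws ! t" if "x \<in> set X" for x
        using that p(3,4) by (auto simp: X set_zip)
      have "x \<circ> x' = x' \<circ> x" if x: "x \<in> set X" "x' \<in> set X" for x x'
      proof -
        obtain t t' where t: "t < j" "x = xs ! t \<circ> ws ! t" "t' < j" "x' = xs ! t' \<circ> ws ! t'"
          using el[OF x(1)] el[OF x(2)] by metis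
        \<comment> \<open>The interchange law: factors over \<open>U\<close> and over
          \<open>I - U\<close> commute, so commutation can be checked in each part.\<close>
        have split: "(a \<circ> b) \<circ> (a' \<circ> b') = (a \<circ> a') \<circ> (b \<circ> b')" if "b \<circ> a' = a' \<circ> b"
          for a b a' b' :: "'i \<times> 'a \<Rightarrow> 'i \<times> 'a"
          using that by (metis comp_assoc)
        have "x \<circ> x' = (xs ! t \<circ> xs ! t') \<circ> (ws ! t \<circ> ws ! t')"
          unfolding t(2,4) by (rule split[OF aut_disjoint_commute[OF fI(1)[OF t(3)] fI(2)[OF t(1)]]])
        also have "xs ! t \<circ> xs ! t' = xs ! t' \<circ> xs ! t" using p(3,7) t by (intro commuting_setD) auto
        also have "ws ! t \<circ> ws ! t' = ws ! t' \<circ> ws ! t" using p(4,8) t by (intro commuting_setD) auto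
        also have "(xs ! t' \<circ> xs ! t) \<circ> (ws ! t' \<circ> ws ! t) = x' \<circ> x"
          unfolding t(2,4) by (rule split[OF aut_disjoint_commute[OF fI(1)[OF t(1)] fI(2)[OF t(3)]], symmetric])
        finally show ?thesis .
      qed
      moreover have "x \<in> aut I" if x: "x \<in> set X" for x
      proof -
        obtain t where t: "t < j" "x = xs ! t \<circ> ws ! t" using el[OF x] by metis
        show ?thesis unfolding t(2) using fI[OF t(1)] p(2) by (intro comp_aut) (auto intro: aut_mono)
      qed
      moreover have "length X = j" using X p(3,4) by simp
      ultimately show "X \<in> ?A I" by (auto simp: comp_lists_def commuting_set_def)
    next
      fix X assume "X \<in> ?A I"
      then have X: "length X = j" "set X \<subseteq> aut I" "commuting_set (set X)" by (auto simp: comp_lists_def)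
      have perm: "b permutes I" if "b \<in> base ` set X" for b using that X(2) base_permutes by auto
      have "\<exists>U. i0 \<in> U \<and> U \<subseteq> I \<and> (\<forall>f\<in>base ` set X. f ` U \<subseteq> U) \<and> transitive_on (base ` set X) U"
        by (rule orbit_exists[OF fin perm i0])
      then obtain U where U: "i0 \<in> U" "U \<subseteq> I" "\<forall>f\<in>base ` set X. f ` U \<subseteq> U" "transitive_on (base ` set X) U"
        by (elim exE conjE)
      have st: "base x ` U \<subseteq> U" "base x ` (I - U) \<subseteq> I - U" "x \<in> aut I" if x: "x \<in> set X" for x
      proof -
        show 1: "base x ` U \<subseteq> U" using U(3) x by simp
        show xI: "x \<in> aut I" using X(2) x by auto
        have inj: "inj (base x)" by (rule permutes_inj[OF base_permutes[OF xI]])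
        have "finite U" using U(2) fin by (rule finite_subset)
        then have "base x ` U = U" using 1 inj_on_subset[OF inj subset_UNIV] by (simp add: endo_inj_surj)
        moreover have "base x ` I = I" by (rule permutes_image[OF base_permutes[OF xI]])
        ultimately show "base x ` (I - U) \<subseteq> I - U" using image_set_diff[OF inj, of I U] by simp
      qed
      let ?xs = "map (restr U) X" and ?ws = "map (restr (I - U)) X"
      have r1: "restr U x \<in> aut U" and r2: "restr (I - U) x \<in> aut (I - U)" if "x \<in> set X" for x
        using restr_aut[OF fin st(3)[OF that] U(2) st(1)[OF that]]
          restr_aut[OF fin st(3)[OF that] _ st(2)[OF that]] by auto
      have "commuting_set (restr U ` set X)" "commuting_set (restr (I - U) ` set X)"
        using restr_comp[OF st(3) st(1)] restr_comp[OF st(3) st(2)] by (auto intro!: commuting_set_image[OF X(3)])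
      then have c: "commuting_set (set ?xs)" "commuting_set (set ?ws)" by simp_all
      have "transitive_on (base ` set ?xs) U"
        by (rule transitive_on_cong[OF U(4)]) (auto simp: base_restr)
      then have "(?xs, []) \<in> trans_tuples j U 0" using c(1) X(1) r1 by (auto simp: trans_tuples_def)
      moreover have "?ws \<in> ?A (I - U)" using c(2) X(1) r2 by (auto simp: comp_lists_def)
      ultimately have "(U, (?xs, []), ?ws) \<in> ?D" using U(1,2) by simp
      moreover have "X = ?h (U, (?xs, []), ?ws)"
      proof -
        have e: "x = restr U x \<circ> restr (I - U) x" if x: "x \<in> set X" for x
        proof (rule aut_eqI[OF st(3)[OF x]])
          show "restr U x \<circ> restr (I - U) x \<in> aut I"
            using r1[OF x] r2[OF x] U(2) by (intro comp_aut) (auto intro: aut_mono)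
          show "x (i, a) = (restr U x \<circ> restr (I - U) x) (i, a)" if "i \<in> I" for i a
            unfolding aut_union_apply[OF r1[OF x] r2[OF x]] using that by simp
        qed
        have "map2 (\<circ>) ?xs ?ws = map (\<lambda>x. restr U x \<circ> restr (I - U) x) X"
          by (induction X) simp_all
        also have "\<dots> = X" using e by (intro map_idI) simp
        finally show ?thesis by simp
      qed
      ultimately show "X \<in> ?h ` ?D" by (rule rev_image_eqI)
    qed
  qed
  then have "card (?A I) = card ?D" by (rule bij_betw_same_card[symmetric])
  also have "\<dots> = (\<Sum>U\<in>?S. card (trans_tuples j U 0 \<times> ?A (I - U)))"
  proof (rule card_SigmaI)
    show "finite ?S" using fin by auto
    show "\<forall>U\<in>?S. finite (trans_tuples j U 0 \<times> ?A (I - U))"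
    proof
      fix U assume "U \<in> ?S"
      then have "finite U" using fin finite_subset by auto
      moreover have "?A (I - U) \<subseteq> {xs. set xs \<subseteq> aut (I - U) \<and> length xs = j}" by (auto simp: comp_lists_def)
      then have "finite (?A (I - U))"
        by (rule finite_subset) (use fin in \<open>intro finite_lists_length_eq finite_aut finite_Diff\<close>)
      ultimately show "finite (trans_tuples j U 0 \<times> ?A (I - U))" by (simp add: finite_trans_tuples)
    qed
  qed
  also have "\<dots> = (\<Sum>U\<in>?S. card (trans_tuples j U 0) * card (?A (I - U)))"
    by (simp only: card_cartesian_product)
  finally show ?thesis .
qed

lemma card_comp_lists_aut_empty: "card (comp_lists j (aut ({} :: 'i set))) = 1"
proof -
  have "f = id" if "f \<in> aut ({} :: 'i set)" for f
    by (rule aut_eqI[OF that id_aut]) simp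
  then have aut: "aut ({} :: 'i set) = {id}" using id_aut by auto
  have "comp_lists j (aut ({} :: 'i set)) = {replicate j id}"
    unfolding aut comp_lists_def by (auto simp: replicate_eqI subset_iff commuting_set_def)
  then show ?thesis by simp
qed

definition num_tuples :: "nat \<Rightarrow> nat \<Rightarrow> nat" where
  "num_tuples j n = card (comp_lists j (aut {0..<n}))"

text \<open>Stated for any \<open>I\<close> of size n, with independence of the underlying set
  assumed for smaller sizes only. It thus yields first that independence in size n and then the
  recurrence.\<close>

lemma num_tuples_rec_aux:
  fixes I :: "nat set"
  assumes "finite I" "card I = n" "0 < n"
    and IH: "\<And>J :: nat set. finite J \<Longrightarrow> card J < n \<Longrightarrow> card (comp_lists j (aut J)) = num_tuples j (card J)"
  shows "card (comp_lists j (aut I)) = (\<Sum>d=1..n. (n - 1 choose (d - 1)) *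
    (fact (d - 1) * card L ^ (d - 1) * sublattices j d * card (comp_lists j L) * num_tuples j (n - d)))"
proof -
  obtain i0 where i0: "i0 \<in> I" using assms by (auto simp: card_gt_0_iff)
  define g where "g d = fact (d - 1) * card L ^ (d - 1) * sublattices j d * card (comp_lists j L) *
    num_tuples j (n - d)" for d
  have "card (comp_lists j (aut I)) = (\<Sum>U | U \<subseteq> I \<and> i0 \<in> U. g (card U))"
    unfolding card_comp_lists_aut_rec[OF assms(1) i0]
  proof (rule sum.cong)
    fix U assume "U \<in> {U. U \<subseteq> I \<and> i0 \<in> U}"
    then have U: "U \<subseteq> I" "i0 \<in> U" "finite U" using assms(1) finite_subset by auto
    have "card (I - U) = n - card U" using U assms(2) by (simp add: card_Diff_subset)
    moreover have "0 < card U" using U by (auto simp: card_gt_0_iff)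
    ultimately have "card (comp_lists j (aut (I - U))) = num_tuples j (n - card U)"
      using IH[of "I - U"] assms(1,3) by simp
    then show "card (trans_tuples j U 0) * card (comp_lists j (aut (I - U))) = g (card U)"
      using card_trans_tuples[OF U(3), of j 0] by (simp only: g_def add_0_right)
  qed simp
  also have "\<dots> = (\<Sum>d=1..n. (n - 1 choose (d - 1)) * g d)"
    unfolding assms(2)[symmetric] by (rule sum_subsets_containing[OF assms(1) i0])
  finally show ?thesis unfolding g_def .
qed

text \<open>The recurrence has the same right-hand side for \<open>I\<close> and for
  \<open>{0..<card I}\<close>, so no isomorphism between the automorphism groups has to be
  constructed.\<close>

lemma card_comp_lists_aut:
  fixes I :: "nat set"
  assumes "finite I"
  shows "card (comp_lists j (aut I)) = num_tuples j (card I)"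
  using assms
proof (induction "card I" arbitrary: I rule: less_induct)
  case less
  show ?case
  proof (cases "card I = 0")
    case True
    then show ?thesis using less.prems by (simp add: num_tuples_def)
  next
    case False
    then have n: "0 < card I" by simp
    have IH: "card (comp_lists j (aut J)) = num_tuples j (card J)"
      if "finite J" "card J < card I" for J :: "nat set" using less.hyps[OF that(2,1)] .
    show ?thesis
      using num_tuples_rec_aux[OF less.prems refl n IH] num_tuples_rec_aux[OF _ _ n IH, of "{0..<card I}"]
      by (simp only: num_tuples_def[of j "card I"] finite_atLeastLessThan card_atLeastLessThan diff_zero)
  qed
qed

lemma num_tuples_rec:
  assumes "0 < n"
  shows "num_tuples j n = (\<Sum>d=1..n. (n - 1 choose (d - 1)) *
    (fact (d - 1) * card L ^ (d - 1) * sublattices j d * card (comp_lists j L) * num_tuples j (n - d)))"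
  unfolding num_tuples_def[of j n]
  by (rule num_tuples_rec_aux[OF _ _ assms card_comp_lists_aut]) simp_all

lemma num_tuples_0: "num_tuples j 0 = 1"
  unfolding num_tuples_def using card_comp_lists_aut_empty[of j] by simp

text \<open>The denominator is the order of the wreath product of \<open>L\<close> with the
  symmetric group on n points.\<close>

definition norm_tuples :: "nat \<Rightarrow> rat fps" where
  "norm_tuples j = Abs_fps (\<lambda>n. of_nat (num_tuples j n) / of_nat (card L ^ n * fact n))"

text \<open>Divide the recurrence by (n - 1)! times the n-th power of \<open>card L\<close>. The
  binomial coefficient cancels against the factorials, and the exponent d - 1 in place of d leaves
  one factor \<open>card L\<close> in the denominator of the constant.\<close>

lemma norm_tuples_log_deriv:
  "fps_X * fps_deriv (norm_tuples j) = norm_tuples j *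
     (fps_const (of_nat (card (comp_lists j L)) / of_nat (card L)) * Abs_fps (\<lambda>n. of_nat (sublattices j n)))"
proof (rule fps_ext)
  fix n
  let ?C = "of_nat (card (comp_lists j L)) :: rat" and ?q = "of_nat (card L) :: rat"
  let ?a = "\<lambda>n. of_nat (num_tuples j n) / (?q ^ n * fact n) :: rat"
  have q: "?q \<noteq> 0" using finite_L id_L by auto
  have "(fps_X * fps_deriv (norm_tuples j)) $ n = of_nat n * ?a n"
    unfolding fps_X_mult_deriv_nth by (simp add: norm_tuples_def)
  also have "\<dots> = (\<Sum>d=1..n. ?C / ?q * of_nat (sublattices j d) * ?a (n - d))"
  proof (cases "n = 0")
    case False
    then have n: "0 < n" by simp
    have "of_nat n * ?a n = of_nat (num_tuples j n) / (?q ^ n * fact (n - 1))"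
      using n by (cases n) (simp_all add: field_simps del: of_nat_Suc)
    also have "\<dots> = (\<Sum>d=1..n. of_nat ((n - 1 choose (d - 1)) *
      (fact (d - 1) * card L ^ (d - 1) * sublattices j d * card (comp_lists j L) * num_tuples j (n - d)))
       / (?q ^ n * fact (n - 1)))"
      unfolding num_tuples_rec[OF n] of_nat_sum sum_divide_distrib ..
    also have "\<dots> = (\<Sum>d=1..n. ?C / ?q * of_nat (sublattices j d) * ?a (n - d))"
    proof (rule sum.cong)
      fix d assume "d \<in> {1..n}"
      then have d: "1 \<le> d" "d \<le> n" by auto
      have f: "fact (n - 1) = (of_nat (n - 1 choose (d - 1)) * (fact (d - 1) * fact (n - d)) :: rat)"
        using arg_cong[OF choose_fact_shift[OF d], of "of_nat :: nat \<Rightarrow> rat"] by (simp only: of_nat_mult of_nat_fact)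
      have "n = Suc (d - 1) + (n - d)" using d by simp
      then have "?q ^ n = ?q ^ (Suc (d - 1) + (n - d))" by (rule arg_cong)
      also have "\<dots> = ?q * ?q ^ (d - 1) * ?q ^ (n - d)" by (simp only: power_add power_Suc)
      finally have qn: "?q ^ n = ?q * ?q ^ (d - 1) * ?q ^ (n - d)" .
      have b: "(of_nat (n - 1 choose (d - 1)) :: rat) \<noteq> 0" using d by simp
      define B F P R where "B = (of_nat (n - 1 choose (d - 1)) :: rat)" and "F = (fact (d - 1) :: rat)"
        and "P = ?q ^ (d - 1)" and "R = ?q ^ (n - d)"
      have nz: "B \<noteq> 0" "F \<noteq> 0" "P \<noteq> 0" "R \<noteq> 0" using b q by (simp_all add: B_def F_def P_def R_def)
      have "of_nat ((n - 1 choose (d - 1)) *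
        (fact (d - 1) * card L ^ (d - 1) * sublattices j d * card (comp_lists j L) * num_tuples j (n - d)))
         = B * (F * P * of_nat (sublattices j d) * ?C * of_nat (num_tuples j (n - d)))"
        by (simp add: B_def F_def P_def del: sublattices.simps)
      then show "of_nat ((n - 1 choose (d - 1)) *
        (fact (d - 1) * card L ^ (d - 1) * sublattices j d * card (comp_lists j L) * num_tuples j (n - d)))
         / (?q ^ n * fact (n - 1)) = ?C / ?q * of_nat (sublattices j d) * ?a (n - d)"
        unfolding f qn using nz q
        by (simp only: B_def[symmetric] F_def[symmetric] P_def[symmetric] R_def[symmetric]) (simp add: field_simps)
    qed simp
    finally show ?thesis .
  qed simp
  \<comment> \<open>The term d = 0 may be added because \<open>sublattices\<close> vanishes at 0;
    the sum is then a Cauchy product.\<close>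
  also have "\<dots> = (\<Sum>d=0..n. ?C / ?q * of_nat (sublattices j d) * ?a (n - d))"
    by (rule sum.mono_neutral_left) (auto simp: not_less_eq_eq le_Suc_eq)
  also have "\<dots> = (\<Sum>i=0..n. ?a i * (?C / ?q * of_nat (sublattices j (n - i))))"
    by (rule sum.reindex_bij_witness[of _ "\<lambda>i. n - i" "\<lambda>i. n - i"]) (auto simp: mult_ac)
  also have "\<dots> = (norm_tuples j * (fps_const (?C / ?q) * Abs_fps (\<lambda>n. of_nat (sublattices j n)))) $ n"
    unfolding fps_mult_nth[of "norm_tuples j"] by (simp add: norm_tuples_def)
  finally show "(fps_X * fps_deriv (norm_tuples j)) $ n =
     (norm_tuples j * (fps_const (?C / ?q) * Abs_fps (\<lambda>n. of_nat (sublattices j n)))) $ n" .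
qed

end

section \<open>The wreath product\<close>

lemma card_commuting_tuples:
  "card (commuting_tuples k H) = card (comm_lists (mult H) (Suc k) (carrier H))"
proof -
  have "bij_betw (\<lambda>x. map x [0..<Suc k]) (commuting_tuples k H) (comm_lists (mult H) (Suc k) (carrier H))"
  proof (rule bij_betwI[where g = "\<lambda>xs. \<lambda>i\<in>{0..k}. xs ! i"])
    show "(\<lambda>x. map x [0..<Suc k]) \<in> commuting_tuples k H \<rightarrow> comm_lists (mult H) (Suc k) (carrier H)"
      by (auto simp: commuting_tuples_def comm_lists_def PiE_iff less_Suc_eq_le simp del: upt_Suc)
    show "(\<lambda>xs. \<lambda>i\<in>{0..k}. xs ! i) \<in> comm_lists (mult H) (Suc k) (carrier H) \<rightarrow> commuting_tuples k H"
    proof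
      fix xs assume "xs \<in> comm_lists (mult H) (Suc k) (carrier H)"
      then have xs: "length xs = Suc k" "set xs \<subseteq> carrier H"
        "\<And>a b. a \<in> set xs \<Longrightarrow> b \<in> set xs \<Longrightarrow> a \<otimes>\<^bsub>H\<^esub> b = b \<otimes>\<^bsub>H\<^esub> a" by (auto simp: comm_lists_def)
      have "xs ! i \<in> set xs" if "i \<le> k" for i using that xs(1) by simp
      then show "(\<lambda>i\<in>{0..k}. xs ! i) \<in> commuting_tuples k H"
        using xs(2,3) by (auto simp: commuting_tuples_def)
    qed
    show "(\<lambda>i\<in>{0..k}. map x [0..<Suc k] ! i) = x" if "x \<in> commuting_tuples k H" for x
    proof
      fix i
      have x: "x \<in> {0..k} \<rightarrow>\<^sub>E carrier H" using that by (simp add: commuting_tuples_def)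
      show "(\<lambda>i\<in>{0..k}. map x [0..<Suc k] ! i) i = x i"
        using PiE_arb[OF x, of i] by (cases "i \<in> {0..k}") (auto simp del: upt_Suc)
    qed
    show "map (\<lambda>i\<in>{0..k}. xs ! i) [0..<Suc k] = xs" if "xs \<in> comm_lists (mult H) (Suc k) (carrier H)" for xs
      using that by (intro nth_equalityI) (auto simp: comm_lists_def simp del: upt_Suc)
  qed
  then show ?thesis by (rule bij_betw_same_card)
qed

context group begin

text \<open>Being the identity off the carrier makes each translation by a group element a bijection
  of the whole type, so products become plain compositions.\<close>

definition left_mult :: "'a \<Rightarrow> 'a \<Rightarrow> 'a" where
  "left_mult g x = (if x \<in> carrier G then g \<otimes> x else x)"

lemma left_mult_comp:
  "g \<in> carrier G \<Longrightarrow> h \<in> carrier G \<Longrightarrow> left_mult (g \<otimes> h) = left_mult g \<circ> left_mult h"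
  by (auto simp: left_mult_def fun_eq_iff m_assoc)

lemma left_mult_one: "left_mult \<one> = id"
  by (auto simp: left_mult_def fun_eq_iff)

lemma inj_left_mult: "inj_on left_mult (carrier G)"
proof (rule inj_onI)
  fix g h assume gh: "g \<in> carrier G" "h \<in> carrier G" "left_mult g = left_mult h"
  show "g = h" using fun_cong[OF gh(3), of \<one>] gh(1,2) by (simp add: left_mult_def)
qed

lemma bij_group_left_mult:
  assumes "finite (carrier G)"
  shows "bij_group (left_mult ` carrier G)"
proof
  show "finite (left_mult ` carrier G)" using assms by simp
  show "id \<in> left_mult ` carrier G" using left_mult_one by (metis image_eqI one_closed)
  show "f \<circ> g \<in> left_mult ` carrier G" if fg: "f \<in> left_mult ` carrier G" "g \<in> left_mult ` carrier G" for f g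
  proof -
    obtain a b where ab: "a \<in> carrier G" "f = left_mult a" "b \<in> carrier G" "g = left_mult b" using fg by auto
    show ?thesis unfolding ab(2,4) left_mult_comp[OF ab(1,3), symmetric] using ab by simp
  qed
  show "\<exists>g\<in>left_mult ` carrier G. g \<circ> f = id \<and> f \<circ> g = id" if f: "f \<in> left_mult ` carrier G" for f
  proof -
    obtain a where a: "a \<in> carrier G" "f = left_mult a" using f by auto
    have "left_mult (inv a) \<circ> left_mult a = id" "left_mult a \<circ> left_mult (inv a) = id"
      using a left_mult_comp[of "inv a" a] left_mult_comp[of a "inv a"] left_mult_one by simp_all
    then show ?thesis using a by auto
  qed
qed

lemma card_commuting_tuples_left_mult:
  "card (commuting_tuples k G) = card (comp_lists (Suc k) (left_mult ` carrier G))"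
  unfolding card_commuting_tuples comp_lists_eq
proof (rule card_comm_lists_iso)
  show "bij_betw left_mult (carrier G) (left_mult ` carrier G)"
    using inj_left_mult by (simp add: bij_betw_def)
qed (simp_all add: left_mult_comp)

lemma card_carrier_wreath:
  assumes "finite (carrier G)"
  shows "card (carrier (wreath G n)) = card (carrier G) ^ n * fact n"
proof -
  have "card {s. s permutes {0..<n}} = fact n" by (rule card_permutations) auto
  moreover have "card ({0..<n} \<rightarrow>\<^sub>E carrier G) = card (carrier G) ^ n" by (simp add: card_funcsetE)
  ultimately show ?thesis by (simp add: wreath_def card_cartesian_product)
qed

text \<open>The wreath product is isomorphic to the automorphism group of the trivial bundle over n
  points whose fibre maps are left translations.\<close>

lemma card_commuting_tuples_wreath:
  assumes fin: "finite (carrier G)"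
  shows "card (commuting_tuples k (wreath G n)) = bij_group.num_tuples (left_mult ` carrier G) (Suc k) n"
proof -
  interpret bij_group "left_mult ` carrier G" by (rule bij_group_left_mult[OF fin])
  let ?N = "{0..<n}"
  let ?W = "wreath G n"
  \<comment> \<open>The multiplication rule attaches \<open>g i\<close> to the target point i, while
    fibre maps are indexed by their source; hence the argument \<open>s i\<close>.\<close>
  define h where "h = (\<lambda>(g :: nat \<Rightarrow> 'a, s :: nat \<Rightarrow> nat). bundle_map s (\<lambda>i. if i \<in> ?N then left_mult (g (s i)) else id))"
  have car: "carrier ?W = (?N \<rightarrow>\<^sub>E carrier G) \<times> {s. s permutes ?N}" by (simp add: wreath_def)
  have mul: "(g, s) \<otimes>\<^bsub>?W\<^esub> (g', s') = ((\<lambda>i\<in>?N. g i \<otimes> g' (inv_into UNIV s i)), s \<circ> s')" for g s g' s'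
    by (simp add: wreath_def)
  have bij: "bij_betw h (carrier ?W) (aut ?N)"
  proof (rule bij_betw_imageI)
    show "inj_on h (carrier ?W)"
    proof (rule inj_onI)
      fix p p' assume pp: "p \<in> carrier ?W" "p' \<in> carrier ?W" "h p = h p'"
      obtain g s g' s' where p: "p = (g, s)" "p' = (g', s')" by (cases p; cases p')
      have gs: "g \<in> ?N \<rightarrow>\<^sub>E carrier G" "g' \<in> ?N \<rightarrow>\<^sub>E carrier G" "s permutes ?N"
        using pp p car by auto
      have ss: "s = s'" using arg_cong[OF pp(3), of base] by (simp add: p h_def)
      have "(\<lambda>i. if i \<in> ?N then left_mult (g (s i)) else id) = (\<lambda>i. if i \<in> ?N then left_mult (g' (s i)) else id)"
        using arg_cong[OF pp(3), of fibre] by (simp only: p h_def prod.case fibre_bundle_map ss)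
      then have eq: "left_mult (g (s i)) = left_mult (g' (s i))" if "i \<in> ?N" for i
        using that by (metis (no_types, lifting))
      have "g i = g' i" if i: "i \<in> ?N" for i
      proof -
        have "inv_into UNIV s i \<in> ?N" using permutes_in_image[OF permutes_inv[OF gs(3)]] i by simp
        from eq[OF this] have "left_mult (g i) = left_mult (g' i)" by (simp only: permutes_inverses(1)[OF gs(3)])
        then show ?thesis using inj_onD[OF inj_left_mult] PiE_mem[OF gs(1) i] PiE_mem[OF gs(2) i] by simp
      qed
      then have "g = g'" by (rule PiE_ext[OF gs(1,2)])
      then show "p = p'" using p ss by simp
    qed
    show "h ` carrier ?W = aut ?N"
    proof (intro equalityI subsetI)
      fix f assume "f \<in> h ` carrier ?W"
      then obtain g s where f: "g \<in> ?N \<rightarrow>\<^sub>E carrier G" "s permutes ?N"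
        "f = bundle_map s (\<lambda>i. if i \<in> ?N then left_mult (g (s i)) else id)"
        unfolding car h_def by auto
      have "left_mult (g (s i)) \<in> left_mult ` carrier G" if "i \<in> ?N" for i
        using PiE_mem[OF f(1), of "s i"] permutes_in_image[OF f(2), of i] that by auto
      then show "f \<in> aut ?N" unfolding aut_def f(3) mem_Collect_eq using f(2)
        by (intro exI[of _ s] exI[of _ "\<lambda>i. if i \<in> ?N then left_mult (g (s i)) else id"]) simp
    next
      fix f assume "f \<in> aut ?N"
      then obtain s c where f: "f = bundle_map s c" "s permutes ?N" "\<And>i. i \<in> ?N \<Longrightarrow> c i \<in> left_mult ` carrier G"
        "\<And>i. i \<notin> ?N \<Longrightarrow> c i = id" using autE by metis
      have "\<exists>x\<in>carrier G. c i = left_mult x" if "i \<in> ?N" for i using f(3)[OF that] by auto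
      then obtain d where d: "\<And>i. i \<in> ?N \<Longrightarrow> d i \<in> carrier G" "\<And>i. i \<in> ?N \<Longrightarrow> c i = left_mult (d i)" by metis
      \<comment> \<open>Passes from source to target indexing, inverting \<open>h\<close>.\<close>
      let ?g = "\<lambda>i\<in>?N. d (inv_into UNIV s i)"
      have g: "?g \<in> ?N \<rightarrow>\<^sub>E carrier G"
        using d(1) permutes_in_image[OF permutes_inv[OF f(2)]] by (intro restrict_PiE_iff[THEN iffD2]) simp
      have "c i = (if i \<in> ?N then left_mult (?g (s i)) else id)" for i
        using f(4)[of i] d(2)[of i] permutes_in_image[OF f(2), of i] permutes_inverses(2)[OF f(2)] by simp
      then have "c = (\<lambda>i. if i \<in> ?N then left_mult (?g (s i)) else id)" by (rule ext)
      then have "f = h (?g, s)" by (simp only: f(1) h_def prod.case)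
      moreover have "(?g, s) \<in> carrier ?W" unfolding car using g f(2) by simp
      ultimately show "f \<in> h ` carrier ?W" by (rule image_eqI)
    qed
  qed
  have hom: "h (p \<otimes>\<^bsub>?W\<^esub> p') = h p \<circ> h p' \<and> p \<otimes>\<^bsub>?W\<^esub> p' \<in> carrier ?W"
    if pp: "p \<in> carrier ?W" "p' \<in> carrier ?W" for p p'
  proof -
    obtain g s g' s' where p: "p = (g, s)" "p' = (g', s')" by (cases p; cases p')
    have gs: "g \<in> ?N \<rightarrow>\<^sub>E carrier G" "g' \<in> ?N \<rightarrow>\<^sub>E carrier G" "s permutes ?N" "s' permutes ?N"
      using pp p car by auto
    note inN = permutes_in_image[OF gs(3)] permutes_in_image[OF gs(4)] permutes_in_image[OF permutes_inv[OF gs(3)]]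
    let ?g = "\<lambda>i\<in>?N. g i \<otimes> g' (inv_into UNIV s i)"
    have "?g \<in> ?N \<rightarrow>\<^sub>E carrier G"
      using PiE_mem[OF gs(1)] PiE_mem[OF gs(2)] inN(3) by (intro restrict_PiE_iff[THEN iffD2]) simp
    moreover have "s \<circ> s' permutes ?N" using permutes_compose[OF gs(4,3)] .
    ultimately have "p \<otimes>\<^bsub>?W\<^esub> p' \<in> carrier ?W" unfolding p mul car by simp
    moreover have "h (p \<otimes>\<^bsub>?W\<^esub> p') e = (h p \<circ> h p') e" for e
    proof -
      obtain i a where e: "e = (i, a)" by fastforce
      show ?thesis
      proof (cases "i \<in> ?N")
        case True
        have i: "s' i \<in> ?N" "s (s' i) \<in> ?N" using True inN by simp_all
        \<comment> \<open>At the target of i the component \<open>g'\<close> is read at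
          \<open>s' i\<close>, which is where the fibre map of the second factor lands.\<close>
        have "?g (s (s' i)) = g (s (s' i)) \<otimes> g' (s' i)"
          using i by (simp add: permutes_inverses(2)[OF gs(3)])
        then have "left_mult (?g (s (s' i))) = left_mult (g (s (s' i))) \<circ> left_mult (g' (s' i))"
          using left_mult_comp[OF PiE_mem[OF gs(1) i(2)] PiE_mem[OF gs(2) i(1)]] by simp
        then show ?thesis unfolding p mul h_def e using True i by simp
      next
        case False
        then show ?thesis unfolding p mul h_def e using permutes_not_in[OF gs(4) False] by simp
      qed
    qed
    ultimately show ?thesis by (intro conjI ext)
  qed
  show ?thesis
    unfolding card_commuting_tuples num_tuples_def comp_lists_eq
  proof (rule card_comm_lists_iso[OF bij])
    fix p p' assume "p \<in> carrier ?W" "p' \<in> carrier ?W"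
    note * = hom[OF this]
    show "h (p \<otimes>\<^bsub>?W\<^esub> p') = h p \<circ> h p'" by (rule conjunct1[OF *])
    show "p \<otimes>\<^bsub>?W\<^esub> p' \<in> carrier ?W" by (rule conjunct2[OF *])
  qed
qed

end

theorem theorem3:
  fixes G :: "('a, 'b) monoid_scheme" and k :: nat
  assumes "group G" and "finite (carrier G)" and "k \<ge> 1"
  shows "\<exists>Q. (partial_prod k \<longlonglongrightarrow> Q) \<and>
    Abs_fps (\<lambda>n. if n = 0 then 1 else chi k (wreath G n)) = fps_powr Q (- chi k G)"
proof -
  interpret group G by (rule assms(1))
  let ?L = "left_mult ` carrier G"
  interpret L: bij_group ?L by (rule bij_group_left_mult[OF assms(2)])
  have cL: "card ?L = card (carrier G)" by (rule card_image[OF inj_left_mult])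
  have chiG: "chi k G = of_nat (card (comp_lists (Suc k) ?L)) / of_nat (card ?L)"
    unfolding chi_def card_commuting_tuples_left_mult cL ..
  have F: "Abs_fps (\<lambda>n. if n = 0 then 1 else chi k (wreath G n)) = L.norm_tuples (Suc k)"
    unfolding L.norm_tuples_def
  proof (intro arg_cong[of _ _ Abs_fps] ext)
    fix n
    show "(if n = 0 then 1 else chi k (wreath G n)) =
        of_nat (L.num_tuples (Suc k) n) / of_nat (card ?L ^ n * fact n)"
      unfolding chi_def card_commuting_tuples_wreath[OF assms(2)] card_carrier_wreath[OF assms(2)] cL
      by (simp add: L.num_tuples_0)
  qed
  let ?S = "Abs_fps (\<lambda>n. of_nat (sublattices (Suc k) n)) :: rat fps"
  obtain Q where Q: "partial_prod k \<longlonglongrightarrow> Q" "Q $ 0 = 1"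
    "fps_X * fps_deriv Q = Q * Abs_fps (\<lambda>n. - of_nat (sublattices (Suc k) n))"
    using partial_prod_tendsto by metis
  \<comment> \<open>The negative exponent cancels the sign in the logarithmic derivative of
    \<open>Q\<close>, so both sides have the same logarithmic derivative and constant term
    1.\<close>
  have "L.norm_tuples (Suc k) $ n = fps_powr Q (- chi k G) $ n" for n
  proof (rule log_deriv_unique[OF L.norm_tuples_log_deriv fps_powr_log_deriv[OF Q(2,3)] _ _ _ order_refl])
    show "L.norm_tuples (Suc k) $ 0 = fps_powr Q (- chi k G) $ 0"
      by (simp add: L.norm_tuples_def L.num_tuples_0)
  qed (simp_all add: chiG del: sublattices.simps)
  then have "L.norm_tuples (Suc k) = fps_powr Q (- chi k G)" by (rule fps_ext)
  then show ?thesis using Q(1) F by auto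
qed

end
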